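(* Let $\Gamma$ be a directed strongly regular graph with parameters $(22,9,6,3,4)$, and let $\rho$ be an automorphism of $\Gamma$ of prime order $p$. Denote by $f_p$ the number of vertices of $\Gamma$ fixed by $\rho$. Then $p\in\{2,3\}$, and moreover: (1) if $p=2$, then $f_2\in\{0,6,8,10,12,14,16\}$; (2) if $p=3$, then $f_3=1$.
   Context: A directed graph is a pair $\Gamma=(V,E)$ with $E\subseteq V\times V$. A directed strongly regular graph with parameters $(v,k,t,\lambda,\mu)$, written DSRG$(v,k,t,\lambda,\mu)$, is a directed graph on $v$ vertices without loops such that every vertex has in-degree and out-degree $k$, every vertex $x$ has exactly $t$ out-neighbors that are also in-neighbors of $x$, and for every pair of vertices $x,y$ the number of directed paths of length two from $x$ to $y$ is $\lambda$ if $(x,y)\in E$ and $\mu$ if $(x,y)\notin E$ (in particular, for $x=y$ this number is $t$). An automorphism of $\Gamma$ is a permutation $\sigma$ of $V$ with $(x,y)\in E \iff (\sigma(x),\sigma(y))\in E$ for all $x,y\in V$. *)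

theory Defs
  imports
    "Graph_Theory.Pair_Digraph"
    "HOL-Algebra.Multiplicative_Group"
    "HOL-Combinatorics.Permutations"
    "HOL-Computational_Algebra.Primes"
begin

text \<open>
  Since there are no parallel arcs, directed paths of length two from \<open>x\<close> to \<open>y\<close> are counted by
  their middle vertices. The case distinction on \<open>(x, y)\<close> is restricted to \<open>x \<noteq> y\<close>: for \<open>x = y\<close>
  the middle vertices are the out-neighbours of \<open>x\<close> that are also in-neighbours, and their number
  is \<open>t\<close> by \<open>reciprocal\<close>.
\<close>

locale dsrg = pair_digraph G for G :: "'a pair_pre_digraph" +
  fixes v k t lam mu :: nat
  assumes card_verts: "card (pverts G) = v"
    and in_deg: "x \<in> pverts G \<Longrightarrow> in_degree (with_proj G) x = k"
    and out_deg: "x \<in> pverts G \<Longrightarrow> out_degree (with_proj G) x = k"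
    and reciprocal: "x \<in> pverts G \<Longrightarrow>
      card {z \<in> pverts G. (x, z) \<in> parcs G \<and> (z, x) \<in> parcs G} = t"
    and paths_adjacent: "x \<in> pverts G \<Longrightarrow> y \<in> pverts G \<Longrightarrow> (x, y) \<in> parcs G \<Longrightarrow>
      card {z \<in> pverts G. (x, z) \<in> parcs G \<and> (z, y) \<in> parcs G} = lam"
    and paths_nonadjacent: "x \<in> pverts G \<Longrightarrow> y \<in> pverts G \<Longrightarrow> x \<noteq> y \<Longrightarrow> (x, y) \<notin> parcs G \<Longrightarrow>
      card {z \<in> pverts G. (x, z) \<in> parcs G \<and> (z, y) \<in> parcs G} = mu"

definition digraph_automorphism :: "'a pair_pre_digraph \<Rightarrow> ('a \<Rightarrow> 'a) \<Rightarrow> bool" where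
  "digraph_automorphism G \<sigma> \<longleftrightarrow> \<sigma> permutes pverts G \<and>
     (\<forall>x\<in>pverts G. \<forall>y\<in>pverts G. (x, y) \<in> parcs G \<longleftrightarrow> (\<sigma> x, \<sigma> y) \<in> parcs G)"

definition automorphism_group :: "'a pair_pre_digraph \<Rightarrow> ('a \<Rightarrow> 'a) monoid" where
  "automorphism_group G =
     \<lparr> carrier = {\<sigma>. digraph_automorphism G \<sigma>}, mult = (\<circ>), one = id \<rparr>"

text \<open>\<open>group.ord\<close> is only specified for groups, so the next lemma is needed for the order of an
  automorphism to be meaningful.\<close>

lemma group_automorphism_group: "group (automorphism_group G)"
proof (rule groupI)
  fix \<sigma> \<tau>
  assume "\<sigma> \<in> carrier (automorphism_group G)" "\<tau> \<in> carrier (automorphism_group G)"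
  then have s: "digraph_automorphism G \<sigma>" and t: "digraph_automorphism G \<tau>"
    by (simp_all add: automorphism_group_def)
  have sp: "\<sigma> permutes pverts G" and tp: "\<tau> permutes pverts G"
    using s t unfolding digraph_automorphism_def by blast+
  have "(x, y) \<in> parcs G \<longleftrightarrow> ((\<sigma> \<circ> \<tau>) x, (\<sigma> \<circ> \<tau>) y) \<in> parcs G"
    if "x \<in> pverts G" "y \<in> pverts G" for x y
  proof -
    have "(x, y) \<in> parcs G \<longleftrightarrow> (\<tau> x, \<tau> y) \<in> parcs G"
      using t that unfolding digraph_automorphism_def by blast
    also have "\<dots> \<longleftrightarrow> (\<sigma> (\<tau> x), \<sigma> (\<tau> y)) \<in> parcs G"
      using s permutes_in_image[OF tp] that unfolding digraph_automorphism_def by blast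
    finally show ?thesis
      unfolding comp_apply .
  qed
  with permutes_compose[OF tp sp] have "digraph_automorphism G (\<sigma> \<circ> \<tau>)"
    unfolding digraph_automorphism_def by blast
  then show "\<sigma> \<otimes>\<^bsub>automorphism_group G\<^esub> \<tau> \<in> carrier (automorphism_group G)"
    by (simp add: automorphism_group_def)
next
  fix \<sigma>
  assume "\<sigma> \<in> carrier (automorphism_group G)"
  then have s: "digraph_automorphism G \<sigma>"
    by (simp add: automorphism_group_def)
  define \<tau> where "\<tau> = inv_into UNIV \<sigma>"
  have sp: "\<sigma> permutes pverts G"
    using s unfolding digraph_automorphism_def by blast
  have tp: "\<tau> permutes pverts G"
    unfolding \<tau>_def using sp by (rule permutes_inv)
  have "(x, y) \<in> parcs G \<longleftrightarrow> (\<tau> x, \<tau> y) \<in> parcs G"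
    if "x \<in> pverts G" "y \<in> pverts G" for x y
  proof -
    have "(\<tau> x, \<tau> y) \<in> parcs G \<longleftrightarrow> (\<sigma> (\<tau> x), \<sigma> (\<tau> y)) \<in> parcs G"
      using s permutes_in_image[OF tp] that unfolding digraph_automorphism_def by blast
    then show ?thesis
      unfolding \<tau>_def permutes_inverses(1)[OF sp] by (rule sym)
  qed
  with tp have "digraph_automorphism G \<tau>"
    unfolding digraph_automorphism_def by blast
  moreover have "\<tau> \<circ> \<sigma> = id"
    unfolding \<tau>_def using sp by (rule permutes_inv_o(2))
  ultimately show "\<exists>\<tau>\<in>carrier (automorphism_group G).
      \<tau> \<otimes>\<^bsub>automorphism_group G\<^esub> \<sigma> = \<one>\<^bsub>automorphism_group G\<^esub>"
    unfolding automorphism_group_def by auto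
qed (simp_all add: automorphism_group_def digraph_automorphism_def permutes_id comp_assoc)

end

(*
An automorphism of prime order p splits the vertices into the fixed set F and orbits of length p.
Summing A^2 = 2I - A + 4J over orbits gives quadratic equations for the quotient matrix S, where
S t q is the number of arcs from a vertex t to the orbit of q. Together with the 6 reciprocal
arcs at t they give sum_q (p R t q - S t q S q t) = 2p - 2 + S t t, where R counts reciprocal arcs.
For p = 2, 3 each summand with q different from t is at most 1, respectively 2, which forces at
least three orbits; the equations on F, read modulo p, exclude the other small fixed sets for p = 2
and every p >= 5 except p = 11 without fixed points. That case is a convolution equation on Z/11
without a solution. For p = 3 with 10 fixed points the graph on F would be the Petersen graph,
split into two classes by the orbits its vertices are joined to; for 13 fixed points the equations
leave a single 3 x 3 quotient matrix, and then two overlapping hexagons in F are incompatible.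
*)
theory Submission
  imports Defs "HOL-Number_Theory.Cong"
begin

section \<open>The quotient by an automorphism of prime order\<close>

text \<open>The digraph is handled as a 0-1 integer matrix with constant row and column sums and a
  quadratic equation, all of which survive transposition. Fixed points, orbits and representatives
  depend on the permutation alone, and moved orbits all have length p, so reversing the arcs just
  transposes the quotient matrix. Every result on out-arcs thus yields one on in-arcs through
  \<open>dual\<close>; for 10 and 13 fixed points the argument rests on playing the two against each
  other.

  The 6 paths from t back to t are used twice: summed over the orbit of t, as a diagonal entry of
  the squared quotient matrix, and unsummed, as a count of reciprocal arcs. In p times the second
  minus the first the paths through F cancel. Each remaining summand is bounded because
  \<open>R t q\<close> is at most the smaller of m = \<open>S t q\<close> and n =
  \<open>S q t\<close>, and p min(m, n) - m n is at most 1 for p = 2 and at most 2 for p = 3. For p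
  = 3 the value 2 needs m = n = 1 or m = n = 2, so with few orbits the row sums nearly force the
  quotient matrix.\<close>

lemma sum_01_eq_card:
  fixes g :: "'a \<Rightarrow> int"
  assumes "finite A" "\<And>x. g x = 0 \<or> g x = 1"
  shows "(\<Sum>x\<in>A. g x) = int (card {x \<in> A. g x = 1})"
proof -
  have "(\<Sum>x\<in>A. g x) = (\<Sum>x\<in>A. of_bool (g x = 1))"
    by (intro sum.cong refl) (metis assms(2) of_bool_eq(1,2) zero_neq_one)
  then show ?thesis using assms(1) by (simp add: Int_def)
qed

text \<open>In \<open>sq\<close> the parameters 3, 4 and 6 appear as 4 - 1, 4 and 4 + 2. Order p is
  expressed by \<open>rp\<close> and \<open>moved\<close>, in a form that passes to the reversed
  digraph and to nontrivial powers of r.\<close>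

locale cyc_aut =
  fixes V :: "'a set" and a :: "'a \<Rightarrow> 'a \<Rightarrow> int" and r :: "'a \<Rightarrow> 'a" and p :: nat
  assumes finV: "finite V" and cardV: "card V = 22"
    and a01: "a x y = 0 \<or> a x y = 1"
    and noloop: "x \<in> V \<Longrightarrow> a x x = 0"
    and rowsum: "x \<in> V \<Longrightarrow> (\<Sum>y\<in>V. a x y) = 9"
    and colsum: "x \<in> V \<Longrightarrow> (\<Sum>y\<in>V. a y x) = 9"
    and sq: "x \<in> V \<Longrightarrow> y \<in> V \<Longrightarrow>
      (\<Sum>z\<in>V. a x z * a z y) = 4 - a x y + (if x = y then 2 else 0)"
    and rV: "r permutes V"
    and inv: "x \<in> V \<Longrightarrow> y \<in> V \<Longrightarrow> a (r x) (r y) = a x y"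
    and pp: "prime p"
    and rp: "(r ^^ p) x = x"
    and moved: "\<exists>x\<in>V. r x \<noteq> x"
begin

lemma dual: "cyc_aut V (\<lambda>x y. a y x) r p"
  using finV cardV a01 noloop rowsum colsum sq rV inv pp rp moved
  by unfold_locales (simp_all add: mult.commute)

definition F where "F = {x \<in> V. r x = x}"
definition orb where "orb x = (\<lambda>i. (r ^^ i) x) ` {..<p}"
text \<open>The choice depends on the set \<open>orb x\<close> only, hence agrees for all x in one
  orbit.\<close>

definition T where "T = (\<lambda>x. SOME y. y \<in> orb x) ` (V - F)"
definition S where "S x s = (\<Sum>y\<in>orb s. a x y)"
definition R where "R x s = (\<Sum>y\<in>orb s. a x y * a y x)"

lemma p_pos: "p > 0" using pp prime_gt_0_nat by blast

lemma rpow_mod: "(r ^^ i) x = (r ^^ (i mod p)) x"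
proof -
  have e: "(r ^^ (p * k)) x = x" for k x
    by (induction k) (auto simp: rp funpow_add)
  have "(r ^^ i) x = (r ^^ (i mod p + p * (i div p))) x" by simp
  also have "\<dots> = (r ^^ (i mod p)) x" unfolding funpow_add by (simp add: e)
  finally show ?thesis .
qed

lemma orb_alt: "orb x = range (\<lambda>i. (r ^^ i) x)"
proof -
  have "(r ^^ i) x \<in> orb x" for i
    unfolding orb_def using rpow_mod[of i x] p_pos
    by (intro image_eqI[of _ _ "i mod p"]) auto
  then show ?thesis unfolding orb_def by auto
qed

lemma rpowV: "x \<in> V \<Longrightarrow> (r ^^ i) x \<in> V"
  by (induction i) (use rV in \<open>auto simp: permutes_in_image\<close>)

lemma orbV: "x \<in> V \<Longrightarrow> orb x \<subseteq> V"
  unfolding orb_alt using rpowV by auto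

lemma fin_orb [simp]: "finite (orb x)" unfolding orb_def by simp

lemma orb_self [simp]: "x \<in> orb x"
  unfolding orb_alt by (rule range_eqI[of _ _ 0]) simp

lemma orb_eq: assumes "y \<in> orb x" shows "orb y = orb x"
proof -
  obtain i where i: "y = (r ^^ i) x" "i < p" using assms unfolding orb_def by auto
  have add: "(r ^^ k) ((r ^^ l) z) = (r ^^ (k + l)) z" for k l z
    by (simp add: funpow_add)
  have "orb y \<subseteq> orb x" unfolding orb_alt i add by auto
  moreover have "x = (r ^^ (p - i)) y"
    unfolding i add using i(2) rp[of x] by simp
  then have "(r ^^ k) x = (r ^^ (k + (p - i))) y" for k by (metis add)
  then have "orb x \<subseteq> orb y" unfolding orb_alt by auto
  ultimately show ?thesis by simp
qed

lemma rpow_inj: "inj (r ^^ i)"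
  using rV by (simp add: inj_fn permutes_inj)

text \<open>Since p is prime, i is invertible modulo p, so iterating r^i suitably often acts as r
  itself.\<close>

lemma rpow_fix: assumes "(r ^^ i) x = x" "0 < i" "i < p" shows "r x = x"
proof -
  have fixk: "(r ^^ (k * i)) x = x" for k
    by (induction k) (auto simp: funpow_add assms(1))
  have "coprime i p" using assms pp
    by (metis coprime_commute nat_dvd_not_less prime_imp_coprime)
  moreover have "p > 1" using pp prime_gt_1_nat by blast
  ultimately obtain k where "[i * k = Suc 0] (mod p)" using cong_solve_coprime_nat by blast
  then have "(k * i) mod p = 1" using \<open>p > 1\<close> by (simp add: cong_def mult.commute)
  then show ?thesis using rpow_mod[of "k * i" x] fixk[of k] by simp
qed

lemma orb_inj: assumes "r x \<noteq> x" shows "inj_on (\<lambda>i. (r ^^ i) x) {..<p}"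
proof (rule linorder_inj_onI)
  fix i j assume ij: "i < j" "i \<in> {..<p}" "j \<in> {..<p}"
  show "(r ^^ i) x \<noteq> (r ^^ j) x"
  proof
    assume e: "(r ^^ i) x = (r ^^ j) x"
    have "(r ^^ j) x = (r ^^ i) ((r ^^ (j - i)) x)"
      using ij funpow_add[of i "j - i" r] by (metis add_diff_inverse_nat comp_apply lessThan_iff less_imp_le linorder_not_less)
    with e have "(r ^^ (j - i)) x = x" using rpow_inj[of i] by (metis injD)
    then show False using rpow_fix[of "j - i" x] ij assms by (auto simp: less_imp_diff_less)
  qed
qed auto

lemma card_orb: "r x \<noteq> x \<Longrightarrow> card (orb x) = p"
  unfolding orb_def using orb_inj by (simp add: card_image)

lemma orb_sum: "r x \<noteq> x \<Longrightarrow> (\<Sum>y\<in>orb x. g y) = (\<Sum>i<p. g ((r ^^ i) x))"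
  unfolding orb_def using orb_inj by (simp add: sum.reindex)

lemma FV: "F \<subseteq> V" unfolding F_def by auto
lemma finF [simp]: "finite F" using FV finV finite_subset by blast

lemma r_image_orb: "r ` orb x = orb x"
proof -
  have "r ` orb x \<subseteq> orb x" unfolding orb_alt
    by (auto intro: range_eqI[of _ _ "Suc _"])
  moreover have "card (r ` orb x) = card (orb x)"
    using rpow_inj[of 1] by (intro card_image) (auto simp: inj_on_def)
  ultimately show ?thesis by (simp add: card_subset_eq)
qed

lemma orb_shift: "(\<Sum>y\<in>orb x. g (r y)) = (\<Sum>y\<in>orb x. g y)"
proof -
  have "(\<Sum>y\<in>r ` orb x. g y) = (\<Sum>y\<in>orb x. g (r y))"
    using rpow_inj[of 1] by (intro sum.reindex[unfolded comp_def]) (auto simp: inj_on_def)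
  then show ?thesis by (simp add: r_image_orb)
qed

lemma orb_moved: assumes "x \<in> V - F" shows "orb x \<subseteq> V - F"
proof -
  have "r y \<noteq> y" if y: "y \<in> orb x" for y
  proof
    assume ry: "r y = y"
    have "(r ^^ i) y = y" for i by (induction i) (auto simp: ry)
    then have "orb y = {y}" unfolding orb_alt by auto
    then have "x = y" using orb_eq[OF y] orb_self[of x] by auto
    then show False using ry assms unfolding F_def by auto
  qed
  then show ?thesis using orbV[of x] assms unfolding F_def by auto
qed

lemma T_moved: "T \<subseteq> V - F"
proof
  fix t assume "t \<in> T"
  then obtain x where x: "x \<in> V - F" "t = (SOME y. y \<in> orb x)" unfolding T_def by auto
  have "t \<in> orb x" unfolding x(2) by (rule someI[of _ x]) simp
  then show "t \<in> V - F" using orb_moved[OF x(1)] by auto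
qed

lemma finT [simp]: "finite T" unfolding T_def using finV by auto

lemma T_rep: "t \<in> T \<Longrightarrow> t' \<in> T \<Longrightarrow> t' \<in> orb t \<Longrightarrow> t' = t"
proof -
  assume t: "t \<in> T" "t' \<in> T" "t' \<in> orb t"
  obtain x where x: "t = (SOME y. y \<in> orb x)" using t unfolding T_def by auto
  obtain x' where x': "t' = (SOME y. y \<in> orb x')" using t unfolding T_def by auto
  have "t \<in> orb x" unfolding x by (rule someI[of _ x]) simp
  moreover have "t' \<in> orb x'" unfolding x' by (rule someI[of _ x']) simp
  moreover have "orb t' = orb t" using t orb_eq by blast
  ultimately have "orb x = orb x'" using orb_eq by metis
  then show "t' = t" using x x' by simp
qed

lemma V_decomp: "V = F \<union> (\<Union>t\<in>T. orb t)"
proof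
  show "V \<subseteq> F \<union> (\<Union>t\<in>T. orb t)"
  proof
    fix x assume x: "x \<in> V"
    show "x \<in> F \<union> (\<Union>t\<in>T. orb t)"
    proof (cases "x \<in> F")
      case False
      define t where "t = (SOME y. y \<in> orb x)"
      have "t \<in> orb x" unfolding t_def by (rule someI[of _ x]) simp
      then have "x \<in> orb t" using orb_eq orb_self by metis
      moreover have "t \<in> T" unfolding T_def t_def using x False by auto
      ultimately show ?thesis by auto
    qed auto
  qed
  show "F \<union> (\<Union>t\<in>T. orb t) \<subseteq> V" using FV T_moved orbV by blast
qed

lemma V_sum: "(\<Sum>z\<in>V. g z) = (\<Sum>z\<in>F. g z) + (\<Sum>t\<in>T. \<Sum>z\<in>orb t. g z)"
proof -
  have disj: "F \<inter> (\<Union>t\<in>T. orb t) = {}" using T_moved orb_moved by blast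
  have "(\<Sum>z\<in>V. g z) = (\<Sum>z\<in>F. g z) + (\<Sum>z\<in>(\<Union>t\<in>T. orb t). g z)"
    by (subst V_decomp, subst sum.union_disjoint) (use disj in auto)
  also have "(\<Sum>z\<in>(\<Union>t\<in>T. orb t). g z) = (\<Sum>t\<in>T. \<Sum>z\<in>orb t. g z)"
  proof (rule sum.UNION_disjoint)
    show "\<forall>s\<in>T. \<forall>t\<in>T. s \<noteq> t \<longrightarrow> orb s \<inter> orb t = {}"
      by (metis T_rep disjoint_iff orb_eq orb_self)
  qed auto
  finally show ?thesis .
qed

lemma TV: "t \<in> T \<Longrightarrow> t \<in> V" using T_moved by auto
lemma Tr: "t \<in> T \<Longrightarrow> r t \<noteq> t" using T_moved unfolding F_def by auto
lemma T_orbV: "t \<in> T \<Longrightarrow> z \<in> orb t \<Longrightarrow> z \<in> V" using TV orbV by blast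

lemma card_eq: "card F + p * card T = 22"
proof -
  have "(\<Sum>z\<in>V. 1::nat) = (\<Sum>z\<in>F. 1) + (\<Sum>t\<in>T. \<Sum>z\<in>orb t. 1)" by (rule V_sum)
  also have "\<dots> = card F + (\<Sum>t\<in>T. p)" using card_orb Tr by simp
  finally show ?thesis using cardV by (simp add: mult.commute)
qed

lemma T_ne: "T \<noteq> {}" using moved unfolding T_def F_def by auto

lemma a_const: assumes "x \<in> F" "t \<in> V" "z \<in> orb t" shows "a x z = a x t" "a z x = a t x"
proof -
  have "a x ((r ^^ i) t) = a x t \<and> a ((r ^^ i) t) x = a t x" for i
    by (induction i) (use assms inv[of x "(r ^^ _) t"] inv[of "(r ^^ _) t" x] rpowV FV in
        \<open>auto simp: F_def\<close>)
  then show "a x z = a x t" "a z x = a t x" using assms unfolding orb_alt by auto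
qed

lemma S_const: assumes "t \<in> V" "s \<in> V" "z \<in> orb t" shows "S z s = S t s"
proof -
  have "S (r y) s = S y s" if "y \<in> V" for y
  proof -
    have "S (r y) s = (\<Sum>z\<in>orb s. a (r y) (r z))"
      unfolding S_def using orb_shift[of "a (r y)" s] by simp
    also have "\<dots> = S y s" unfolding S_def
      by (intro sum.cong refl inv that) (use assms orbV in auto)
    finally show ?thesis .
  qed
  then have "S ((r ^^ i) t) s = S t s" for i
    by (induction i) (auto simp: rpowV assms)
  then show ?thesis using assms unfolding orb_alt by auto
qed

lemma S_col_const: assumes "t \<in> V" "s \<in> V" "y \<in> orb s"
  shows "(\<Sum>x\<in>orb t. a x y) = (\<Sum>x\<in>orb t. a x s)"
  using cyc_aut.S_const[OF dual, of s t y] assms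
  unfolding cyc_aut.S_def[OF dual] cyc_aut.orb_def[OF dual] orb_def by simp

text \<open>The arcs between two orbits are counted from either side; both orbits have p elements,
  so p cancels.\<close>

lemma S_col: assumes "t \<in> T" "s \<in> T" shows "(\<Sum>x\<in>orb t. a x s) = S t s"
proof -
  have "(\<Sum>x\<in>orb t. \<Sum>y\<in>orb s. a x y) = (\<Sum>x\<in>orb t. S t s)"
    unfolding S_def[symmetric] by (rule sum.cong[OF refl], rule S_const) (use assms TV in auto)
  then have 1: "(\<Sum>x\<in>orb t. \<Sum>y\<in>orb s. a x y) = p * S t s"
    using card_orb[OF Tr] assms by simp
  have "(\<Sum>x\<in>orb t. \<Sum>y\<in>orb s. a x y) = (\<Sum>y\<in>orb s. \<Sum>x\<in>orb t. a x y)"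
    by (rule sum.swap)
  also have "\<dots> = (\<Sum>y\<in>orb s. \<Sum>x\<in>orb t. a x s)"
    by (rule sum.cong[OF refl], rule S_col_const) (use assms TV in auto)
  finally have "(\<Sum>x\<in>orb t. \<Sum>y\<in>orb s. a x y) = p * (\<Sum>x\<in>orb t. a x s)"
    using card_orb[OF Tr] assms by simp
  with 1 p_pos show ?thesis by simp
qed

lemma orb_sum_F:
  assumes "x \<in> F" "t \<in> T"
  shows "(\<Sum>z\<in>orb t. a x z * g z) = a x t * (\<Sum>z\<in>orb t. g z)"
    and "(\<Sum>z\<in>orb t. g z * a z x) = (\<Sum>z\<in>orb t. g z) * a t x"
proof -
  have "a x z * g z = a x t * g z" "g z * a z x = g z * a t x" if "z \<in> orb t" for z
    using a_const[OF assms(1) TV[OF assms(2)] that] by auto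
  then have "(\<Sum>z\<in>orb t. a x z * g z) = (\<Sum>z\<in>orb t. a x t * g z)"
      "(\<Sum>z\<in>orb t. g z * a z x) = (\<Sum>z\<in>orb t. g z * a t x)"
    by (auto intro: sum.cong)
  then show "(\<Sum>z\<in>orb t. a x z * g z) = a x t * (\<Sum>z\<in>orb t. g z)"
    "(\<Sum>z\<in>orb t. g z * a z x) = (\<Sum>z\<in>orb t. g z) * a t x"
    by (simp_all add: sum_distrib_left sum_distrib_right)
qed

lemma orb_const_sum_F:
  assumes "x \<in> F" "t \<in> T"
  shows "(\<Sum>z\<in>orb t. a x z) = p * a x t"
  using orb_sum_F(1)[OF assms, of "\<lambda>_. 1"] card_orb[OF Tr[OF assms(2)]] by simp

lemma orb_sum_S:
  assumes "s \<in> T" "u \<in> T"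
  shows "(\<Sum>z\<in>orb s. g z * S z u) = (\<Sum>z\<in>orb s. g z) * S s u"
proof -
  have "g z * S z u = g z * S s u" if "z \<in> orb s" for z
    using S_const[OF TV[OF assms(1)] TV[OF assms(2)] that] by simp
  then have "(\<Sum>z\<in>orb s. g z * S z u) = (\<Sum>z\<in>orb s. g z * S s u)"
    by (intro sum.cong) auto
  then show ?thesis by (simp add: sum_distrib_right)
qed

lemma row_F: assumes "x \<in> F"
  shows "(\<Sum>y\<in>F. a x y) + p * (\<Sum>t\<in>T. a x t) = 9"
proof -
  have "(\<Sum>t\<in>T. \<Sum>z\<in>orb t. a x z) = (\<Sum>t\<in>T. p * a x t)"
    using orb_const_sum_F[OF assms] by (intro sum.cong) auto
  then show ?thesis using rowsum[of x] V_sum[of "a x"] assms FV by (auto simp: sum_distrib_left)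
qed

lemma row_T: assumes "t \<in> T" shows "(\<Sum>y\<in>F. a t y) + (\<Sum>s\<in>T. S t s) = 9"
  using rowsum[of t] V_sum[of "a t"] assms TV unfolding S_def by auto

lemma sq_FF: assumes "x \<in> F" "y \<in> F"
  shows "(\<Sum>z\<in>F. a x z * a z y) + p * (\<Sum>t\<in>T. a x t * a t y)
    = 4 - a x y + (if x = y then 2 else 0)"
proof -
  have "(\<Sum>z\<in>orb t. a x z * a z y) = p * (a x t * a t y)" if "t \<in> T" for t
    using orb_sum_F(1)[OF assms(1) that, of "\<lambda>z. a z y"]
      orb_sum_F(2)[OF assms(2) that, of "\<lambda>_. 1"] card_orb[OF Tr[OF that]] by simp
  moreover have "x \<in> V" "y \<in> V" using assms FV by auto
  ultimately show ?thesis using sq[of x y] V_sum[of "\<lambda>z. a x z * a z y"]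
    by (simp add: sum_distrib_left)
qed

lemma sq_FT: assumes "x \<in> F" "t \<in> T"
  shows "(\<Sum>z\<in>F. a x z * a z t) + (\<Sum>s\<in>T. a x s * S s t) = 4 - a x t"
proof -
  have "(\<Sum>s\<in>T. \<Sum>z\<in>orb s. a x z * a z t) = (\<Sum>s\<in>T. a x s * S s t)"
    using orb_sum_F(1)[OF assms(1)] S_col[OF _ assms(2)] by (intro sum.cong) auto
  moreover have "x \<noteq> t" using assms T_moved by auto
  ultimately show ?thesis using sq[of x t] V_sum[of "\<lambda>z. a x z * a z t"] assms FV TV
    by auto
qed

lemma sq_TF: assumes "x \<in> F" "t \<in> T"
  shows "(\<Sum>z\<in>F. a t z * a z x) + (\<Sum>s\<in>T. S t s * a s x) = 4 - a t x"
proof -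
  have "(\<Sum>s\<in>T. \<Sum>z\<in>orb s. a t z * a z x) = (\<Sum>s\<in>T. S t s * a s x)"
    using orb_sum_F(2)[OF assms(1)] by (intro sum.cong) (auto simp: S_def)
  moreover have "x \<noteq> t" using assms T_moved by auto
  ultimately show ?thesis using sq[of t x] V_sum[of "\<lambda>z. a t z * a z x"] assms FV TV
    by auto
qed

text \<open>The path equation from t is summed over the end points in the orbit of u. The constant 4
  is collected p times, the diagonal term at most once.\<close>

lemma sq_TT: assumes "t \<in> T" "u \<in> T"
  shows "p * (\<Sum>z\<in>F. a t z * a z u) + (\<Sum>s\<in>T. S t s * S s u)
    = 4 * int p - S t u + (if t = u then 2 else 0)"
proof -
  have uV: "u \<in> V" and tV: "t \<in> V" using assms TV by auto
  have A: "(\<Sum>y\<in>orb u. \<Sum>z\<in>V. a t z * a z y) = (\<Sum>z\<in>V. a t z * S z u)"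
    unfolding S_def by (subst sum.swap) (simp add: sum_distrib_left)
  have B: "(\<Sum>z\<in>V. a t z * S z u) = (\<Sum>z\<in>F. a t z * S z u) + (\<Sum>s\<in>T. \<Sum>z\<in>orb s. a t z * S z u)"
    by (rule V_sum)
  have C: "(\<Sum>z\<in>F. a t z * S z u) = (\<Sum>z\<in>F. a t z * (p * a z u))"
  proof (intro sum.cong refl arg_cong[of _ _ "(*) _"])
    fix z assume "z \<in> F"
    then show "S z u = p * a z u" unfolding S_def using orb_const_sum_F assms(2) by simp
  qed
  have D: "(\<Sum>s\<in>T. \<Sum>z\<in>orb s. a t z * S z u) = (\<Sum>s\<in>T. S t s * S s u)"
    using orb_sum_S[OF _ assms(2)] by (intro sum.cong) (auto simp: S_def)
  have "(\<Sum>y\<in>orb u. \<Sum>z\<in>V. a t z * a z y) = (\<Sum>y\<in>orb u. 4 - a t y + (if t = y then 2 else 0))"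
    using sq[OF tV] T_orbV[OF assms(2)] by (intro sum.cong) auto
  also have "\<dots> = 4 * int p - S t u + (\<Sum>y\<in>orb u. if t = y then 2 else 0)"
    using card_orb[OF Tr] assms unfolding S_def by (simp add: sum.distrib sum_subtractf)
  also have "(\<Sum>y\<in>orb u. if t = y then 2 else 0) = (if t \<in> orb u then 2 else (0::int))"
    by simp
  also have "t \<in> orb u \<longleftrightarrow> t = u" using T_rep[of u t] assms by auto
  finally show ?thesis using A B C D
    by (simp add: sum_distrib_left mult.left_commute)
qed

section \<open>Reciprocal arcs and bounds on the quotient matrix\<close>

lemma recip_T: assumes "t \<in> T" shows "(\<Sum>z\<in>F. a t z * a z t) + (\<Sum>q\<in>T. R t q) = 6"
  using sq[of t t] V_sum[of "\<lambda>z. a t z * a z t"] assms TV noloop unfolding R_def by auto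

lemma a_ge0: "0 \<le> a x y" using a01[of x y] by auto
lemma a_le1: "a x y \<le> 1" using a01[of x y] by auto

lemma S_ge0: "0 \<le> S x s" unfolding S_def by (intro sum_nonneg a_ge0)
lemma S_le: assumes "s \<in> T" shows "S x s \<le> p"
  using sum_bounded_above[of "orb s" "a x" 1] a_le1 card_orb[OF Tr[OF assms]] unfolding S_def by auto

lemma S_diag_le: assumes "t \<in> T" shows "S t t \<le> int p - 1"
proof -
  have "S t t = (\<Sum>y\<in>orb t - {t}. a t y)" unfolding S_def
    using noloop[OF TV[OF assms]] sum.remove[of "orb t" t "a t"] by simp
  also have "\<dots> \<le> card (orb t - {t})" using sum_bounded_above[of "orb t - {t}" "a t" 1] a_le1 by simp
  also have "\<dots> = int p - 1" using card_orb[OF Tr[OF assms]] p_pos by (simp add: of_nat_diff)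
  finally show ?thesis .
qed

lemma R_le: "R x s \<le> S x s" unfolding R_def S_def
  by (intro sum_mono) (use a01 in \<open>metis a_ge0 a_le1 mult.right_neutral mult_left_mono\<close>)
lemma R_le': assumes "t \<in> T" "s \<in> T" shows "R t s \<le> S s t"
proof -
  have "R t s \<le> (\<Sum>y\<in>orb s. a y t)" unfolding R_def
    by (intro sum_mono) (use a01 in \<open>metis a_ge0 a_le1 mult.left_neutral mult_right_mono\<close>)
  then show ?thesis using S_col assms by simp
qed

text \<open>Here r exchanges t and \<open>r t\<close>, so an arc between them is always
  reciprocal.\<close>

lemma R_diag_2: assumes "p = 2" "t \<in> T" shows "R t t = S t t"
proof -
  have tV: "t \<in> V" and rt: "r t \<noteq> t" using assms TV Tr by auto
  have "r (r t) = t" using rp[of t] assms by (simp add: numeral_2_eq_2)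
  then have "a (r t) t = a t (r t)" using inv[of t "r t"] tV rpowV[of t 1] by auto
  moreover have "{..<p} = {0, 1}" using assms(1) by auto
  then have "S t t = a t t + a t (r t)" "R t t = a t t * a t t + a t (r t) * a (r t) t"
    unfolding S_def R_def orb_sum[OF rt] by simp_all
  ultimately show ?thesis using noloop[OF tV] a01[of t "r t"] by auto
qed

text \<open>An arc from t to \<open>r t\<close> is shifted to one from \<open>r (r t)\<close> to t.
  Arcs within the orbit are therefore reciprocal only when t sends both of them, which gives 0, 0, 2
  for \<open>S t t\<close> = 0, 1, 2.\<close>

lemma R_diag_3: assumes "p = 3" "t \<in> T" shows "R t t = S t t * (S t t - 1)"
proof -
  have tV: "t \<in> V" and rt: "r t \<noteq> t" using assms TV Tr by auto
  have V: "r t \<in> V" "r (r t) \<in> V" using rpowV[OF tV, of 1] rpowV[OF tV, of 2] by (auto simp: numeral_2_eq_2)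
  have 3: "r (r (r t)) = t" using rp[of t] assms by (simp add: numeral_3_eq_3)
  have "a (r t) t = a t (r (r t))" "a (r (r t)) t = a t (r t)"
    using inv[OF tV V(2)] inv[OF V(2) tV] inv[OF tV V(1)] inv[OF V(1) V(2)] inv[OF V(2) V(1)] 3
    by auto
  moreover have "{..<p} = {0, 1, 2}" using assms(1) by auto
  then have "S t t = a t t + a t (r t) + a t (r (r t))"
    "R t t = a t t * a t t + a t (r t) * a (r t) t + a t (r (r t)) * a (r (r t)) t"
    unfolding S_def R_def orb_sum[OF rt] by (simp_all add: numeral_2_eq_2)
  ultimately show ?thesis using noloop[OF tV] a01[of t "r t"] a01[of t "r (r t)"] by auto
qed


definition W where "W t q = int p * R t q - S t q * S q t"

text \<open>The value is 6p - (4p - \<open>S t t\<close> + 2); the sums over F have the same weight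
  p on both sides.\<close>

lemma W_sum: assumes "t \<in> T" shows "(\<Sum>q\<in>T. W t q) = 2 * int p - 2 + S t t"
proof -
  have "(\<Sum>q\<in>T. W t q) = p * (\<Sum>q\<in>T. R t q) - (\<Sum>q\<in>T. S t q * S q t)"
    unfolding W_def by (simp add: sum_subtractf sum_distrib_left)
  moreover have "(\<Sum>q\<in>T. R t q) = 6 - (\<Sum>z\<in>F. a t z * a z t)" using recip_T[OF assms] by simp
  ultimately show ?thesis using sq_TT[OF assms assms] by (simp add: algebra_simps)
qed

lemma W_sum': assumes "t \<in> T"
  shows "(\<Sum>q\<in>T - {t}. W t q) = 2 * int p - 2 + S t t - W t t"
  using W_sum[OF assms] sum.remove[OF finT assms, of "W t"] by simp

section \<open>Counting inside the fixed set; orders at least 5\<close>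

definition b where "b x = (\<Sum>y\<in>F. a x y)"
definition P where "P x y = (\<Sum>z\<in>F. a x z * a z y)"

lemma P_ge0: "0 \<le> P x y" unfolding P_def by (intro sum_nonneg mult_nonneg_nonneg a_ge0)
lemma P_le_b: "P x y \<le> b x" unfolding P_def b_def
  by (intro sum_mono) (metis a_ge0 a_le1 mult.right_neutral mult_left_mono)
lemma b_le: assumes "x \<in> F" shows "b x \<le> int (card F) - 1"
proof -
  have "b x = (\<Sum>y\<in>F - {x}. a x y)" unfolding b_def
    using noloop FV assms sum.remove[of F x "a x"] by auto
  also have "\<dots> \<le> card (F - {x})" using sum_bounded_above[of "F - {x}" "a x" 1] a_le1 by simp
  also have "\<dots> = int (card F) - 1" using assms finF card_gt_0_iff[of F]
    by (auto simp: of_nat_diff)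
  finally show ?thesis .
qed

lemma P_sum: "(\<Sum>y\<in>F. P x y) = (\<Sum>z\<in>F. a x z * b z)"
  unfolding P_def b_def by (subst sum.swap) (simp add: sum_distrib_left)

lemma TT_ge0: "0 \<le> (\<Sum>t\<in>T. a x t * a t y)"
  by (intro sum_nonneg mult_nonneg_nonneg a_ge0)

lemma P_sum_split: assumes "x \<in> F" "\<And>y. y \<in> F \<Longrightarrow> y \<noteq> x \<Longrightarrow> P x y = c - d * a x y"
  shows "(\<Sum>y\<in>F. P x y) = P x x + c * (int (card F) - 1) - d * b x"
proof -
  have "(\<Sum>y\<in>F. P x y) = P x x + (\<Sum>y\<in>F - {x}. P x y)" using assms(1) by (simp add: sum.remove)
  also have "(\<Sum>y\<in>F - {x}. P x y) = (\<Sum>y\<in>F - {x}. c - d * a x y)"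
    using assms by (intro sum.cong) auto
  also have "\<dots> = c * int (card (F - {x})) - d * (\<Sum>y\<in>F - {x}. a x y)"
    by (simp add: sum_subtractf sum_distrib_left)
  also have "(\<Sum>y\<in>F - {x}. a x y) = b x" unfolding b_def
    using noloop FV assms sum.remove[of F x "a x"] by auto
  also have "int (card (F - {x})) = int (card F) - 1" using assms finF card_gt_0_iff[of F]
    by (auto simp: of_nat_diff)
  finally show ?thesis by simp
qed

text \<open>The diagonal equation at a fixed x cannot hold p > 6 paths through an orbit, so all 6
  run inside F and \<open>b x\<close> is at least 6. Then 9 - \<open>b x\<close> is less than p, so
  no arc leaves F, and no path leads from x to a moved vertex although 4 are required.\<close>

lemma large_order_no_fixed_points: assumes "p \<ge> 7" shows "F = {}"
proof (rule ccontr)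
  assume "F \<noteq> {}"
  then obtain x where x: "x \<in> F" by auto
  have z: "a x t = 0" if xF: "x \<in> F" and t: "t \<in> T" for x t
  proof -
    let ?k = "\<Sum>t\<in>T. a x t" and ?l = "\<Sum>t\<in>T. a x t * a t x"
    have "P x x + p * ?l = 6" using sq_FF[OF xF xF] noloop xF FV unfolding P_def by auto
    moreover have "?l = 0"
    proof (rule ccontr)
      assume "?l \<noteq> 0"
      then have "int p * 1 \<le> p * ?l" using TT_ge0[of x x] by (intro mult_left_mono) auto
      then show False using assms calculation P_ge0[of x x] by linarith
    qed
    ultimately have "b x \<ge> 6" using P_le_b[of x x] by simp
    moreover have "b x + p * ?k = 9" using row_F[OF xF] unfolding b_def .
    ultimately have "?k < 1" using assms mult_mono[of 7 "int p" 1 ?k] by (force simp: not_less)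
    moreover have "a x t \<le> ?k" using t by (intro member_le_sum a_ge0) auto
    ultimately show ?thesis using a_ge0[of x t] by linarith
  qed
  obtain t where t: "t \<in> T" using T_ne by auto
  show False using sq_FT[OF x t] z[OF x] z[OF _ t] t by simp
qed

text \<open>Off the diagonal the path counts are below 5, so paths between different fixed vertices
  stay in F and the sum of \<open>b z\<close> over the out-neighbours z of x in F is determined. For
  12 or 17 fixed points \<open>b x\<close> = 4 would make this sum exceed 9 * 4, so b is constantly
  9; for 2 or 7 fixed points b can only be 4. Either constant contradicts the sum or the bound on
  b.\<close>

lemma order_not_5: "p \<noteq> 5"
proof
  assume p5: "p = 5"
  have "card T > 0" using T_ne by (simp add: card_gt_0_iff)
  then have f: "card F \<in> {2, 7, 12, 17}" using card_eq unfolding p5 by simp presburger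
  have 1: "P x x = 1 \<or> P x x = 6" "b x = 4 \<or> b x = 9" if x: "x \<in> F" for x
  proof -
    have e: "P x x + 5 * (\<Sum>t\<in>T. a x t * a t x) = 6"
      using sq_FF[OF x x] noloop x FV p5 unfolding P_def by auto
    then show "P x x = 1 \<or> P x x = 6" using P_ge0[of x x] TT_ge0[of x x] by presburger
    then show "b x = 4 \<or> b x = 9"
    proof -
      have "b x + 5 * (\<Sum>t\<in>T. a x t) = 9" using row_F[OF x] p5 unfolding b_def by simp
      moreover have "0 \<le> (\<Sum>t\<in>T. a x t)" by (intro sum_nonneg a_ge0)
      moreover have "1 \<le> b x" using P_le_b[of x x] \<open>P x x = 1 \<or> P x x = 6\<close> by auto
      ultimately show ?thesis by presburger
    qed
  qed
  have 2: "(\<Sum>z\<in>F. a x z * b z) = P x x + 4 * (int (card F) - 1) - b x" if x: "x \<in> F" for x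
  proof -
    have "P x y = 4 - 1 * a x y" if "y \<in> F" "y \<noteq> x" for y
    proof -
      have "P x y + 5 * (\<Sum>t\<in>T. a x t * a t y) = 4 - a x y"
        using sq_FF[OF x that(1)] that p5 unfolding P_def by simp
      then show ?thesis using P_ge0[of x y] TT_ge0[of x y] a_ge0[of x y] by presburger
    qed
    then show ?thesis using P_sum_split[OF x, of 4 1] P_sum[of x] by simp
  qed
  have 3: "(\<Sum>z\<in>F. a x z * b z) = c * b x" if "x \<in> F" "\<And>z. z \<in> F \<Longrightarrow> b z = c" for x c
    using that(2) unfolding b_def[of x] by (simp add: sum_distrib_left mult.commute)
  have 4: "(\<Sum>z\<in>F. a x z * b z) \<le> 9 * b x" for x
    unfolding b_def[of x] sum_distrib_left
  proof (rule sum_mono)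
    fix z assume "z \<in> F"
    then show "a x z * b z \<le> 9 * a x z" using 1(2)[of z] a01[of x z] by auto
  qed
  obtain x where x: "x \<in> F" using f by fastforce
  show False
  proof (cases "card F \<ge> 12")
    case True
    then have "b z = 9" if "z \<in> F" for z using 1[OF that] 2[OF that] 4[of z] by auto
    then show False using 3[OF x, of 9] 1[OF x] 2[OF x] f by auto
  next
    case False
    then have "b z = 4" if "z \<in> F" for z using 1[OF that] b_le[OF that] f by auto
    then show False using 3[OF x, of 4] 1[OF x] 2[OF x] b_le[OF x] f False by auto
  qed
qed

section \<open>At least three orbits; order 2\<close>

lemma W_le_1: assumes "p = 2" "t \<in> T" "q \<in> T" shows "W t q \<le> 1"
proof -
  have "S t q \<in> {0, 1, 2}" "S q t \<in> {0, 1, 2}"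
    using S_ge0[of t q] S_ge0[of q t] S_le[of q t] S_le[of t q] assms by auto
  then show ?thesis unfolding W_def
    using R_le[of t q] R_le'[of t q] assms by auto
qed

lemma W_bounds_3: assumes "p = 3" "t \<in> T" "q \<in> T"
  shows "W t q \<le> 2" "W t q \<le> 3 * S t q - S t q * S q t" "W t q \<le> 3 * S q t - S t q * S q t"
    and "S t q \<in> {0, 1, 2, 3}"
proof -
  have "S t q \<in> {0, 1, 2, 3}" "S q t \<in> {0, 1, 2, 3}"
    using S_ge0[of t q] S_ge0[of q t] S_le[of q t] S_le[of t q] assms by auto
  then show "W t q \<le> 2" "S t q \<in> {0, 1, 2, 3}" "W t q \<le> 3 * S t q - S t q * S q t"
      "W t q \<le> 3 * S q t - S t q * S q t" unfolding W_def
    using R_le[of t q] R_le'[of t q] assms by auto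
qed

lemma S_diag_3: assumes "p = 3" "t \<in> T" shows "S t t \<in> {0, 1, 2}"
    using S_ge0[of t t] S_diag_le[of t] assms by auto

lemma W_diag_3: assumes "p = 3" "t \<in> T" shows "W t t = S t t * (2 * S t t - 3)"
  unfolding W_def using R_diag_3[OF assms] assms by (simp add: algebra_simps)

text \<open>After removing \<open>W t t\<close>, the remaining row sum is 2 for p = 2, and 4, 6, 4
  for p = 3 and \<open>S t t\<close> = 0, 1, 2. With summands at most 1 and 2 respectively, two
  further orbits are needed.\<close>

lemma card_T_ge3: assumes "p = 2 \<or> p = 3" shows "card T \<ge> 3"
proof -
  obtain t where t: "t \<in> T" using T_ne by auto
  have c: "card (T - {t}) = card T - 1" using t by simp
  have "card (T - {t}) \<ge> 2"
  proof (cases "p = 2")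
    case True
    have "S t t \<in> {0, 1}" using S_ge0[of t t] S_diag_le[of t] True t by auto
    then have "W t t = S t t" unfolding W_def using R_diag_2[OF True t] True by auto
    then show ?thesis
      using W_sum'[OF t] sum_bounded_above[of "T - {t}" "W t" 1] W_le_1[OF True t] True by auto
  next
    case False
    then have 3: "p = 3" using assms by auto
    show ?thesis using W_sum'[OF t] sum_bounded_above[of "T - {t}" "W t" 2] W_bounds_3(1)[OF 3 t]
        S_diag_3[OF 3 t] W_diag_3[OF 3 t] 3 by auto
  qed
  then show ?thesis using c by simp
qed

text \<open>Only 2 and 4 need work; larger values violate the bound on orbits. By
  \<open>row_F\<close> every \<open>b x\<close> is odd. If y were the only out-neighbour of x in F,
  no path from x to y would lie in F, and the odd number 3 would count paths through orbits of
  length 2. So \<open>b x\<close> = 3, F is a complete digraph on 4 vertices, and 6 - 3 paths from x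
  to itself would have to be even in number.\<close>

lemma card_fixed_order_2: assumes p2: "p = 2" shows "card F \<in> {0, 6, 8, 10, 12, 14, 16}"
proof -
  have e: "card F + 2 * card T = 22" using card_eq assms by simp
  have "card F \<noteq> 2 \<and> card F \<noteq> 4"
  proof (rule ccontr)
    assume "\<not> ?thesis"
    then have f: "card F = 2 \<or> card F = 4" by simp
    have par: "odd (b x)" if "x \<in> F" for x
    proof -
      have "b x + 2 * (\<Sum>t\<in>T. a x t) = 9" using row_F[OF that] p2 unfolding b_def by simp
      then show ?thesis by presburger
    qed
    have no1: "b x \<noteq> 1" if x: "x \<in> F" for x
    proof
      assume b1: "b x = 1"
      then obtain y where y: "y \<in> F" "a x y = 1"
        unfolding b_def by (metis a01 sum.neutral zero_neq_one)
      have rest: "a x z = 0" if "z \<in> F" "z \<noteq> y" for z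
      proof -
        have "b x = a x y + (\<Sum>z\<in>F - {y}. a x z)" unfolding b_def using y by (simp add: sum.remove)
        then have "(\<Sum>z\<in>F - {y}. a x z) = 0" using b1 y by simp
        then show ?thesis using that by (subst (asm) sum_nonneg_eq_0_iff) (auto simp: a_ge0)
      qed
      have "P x y = a x y * a y y + (\<Sum>z\<in>F - {y}. a x z * a z y)"
        unfolding P_def using y by (simp add: sum.remove)
      also have "\<dots> = 0" using noloop y(1) FV rest by (auto intro!: sum.neutral)
      finally have "P x y = 0" .
      moreover have "x \<noteq> y" using noloop x FV y by auto
      ultimately have "2 * (\<Sum>t\<in>T. a x t * a t y) = 3"
        using sq_FF[OF x y(1)] y(2) p2 unfolding P_def by simp
      then show False by presburger
    qed
    have b3: "card F = 4 \<and> b x = 3" if "x \<in> F" for x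
    proof -
      have "0 \<le> b x" unfolding b_def by (intro sum_nonneg a_ge0)
      moreover have "b x \<noteq> 0" "b x \<noteq> 2" using par[OF that] by auto
      ultimately show ?thesis using no1[OF that] b_le[OF that] f by auto
    qed
    obtain x where x: "x \<in> F" using f by fastforce
    have all1: "a u y = 1" if uy: "u \<in> F" "y \<in> F" "u \<noteq> y" for u y
    proof (rule ccontr)
      assume "a u y \<noteq> 1"
      then have 0: "a u y = 0" using a01[of u y] by simp
      have "b u = (\<Sum>z\<in>F - {u, y}. a u z)" unfolding b_def
        using 0 noloop uy FV by (intro sum.mono_neutral_right) auto
      also have "\<dots> \<le> card (F - {u, y})" using sum_bounded_above[of "F - {u, y}" "a u" 1] a_le1 by simp
      also have "card (F - {u, y}) = 2" using b3 uy by (subst card_Diff_subset) auto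
      finally show False using b3 uy by simp
    qed
    have "P x x = (\<Sum>z\<in>F - {x}. a x z * a z x)" unfolding P_def
      using noloop FV x by (intro sum.mono_neutral_right) auto
    also have "\<dots> = (\<Sum>z\<in>F - {x}. 1)" using all1 x by (intro sum.cong) auto
    also have "\<dots> = 3" using b3 x by simp
    finally have "3 + 2 * (\<Sum>t\<in>T. a x t * a t x) = 6"
      using sq_FF[OF x x] noloop x FV p2 unfolding P_def by auto
    then show False by presburger
  qed
  moreover have "card T \<ge> 3" using card_T_ge3 p2 by auto
  moreover have "n = 0 \<or> n = 6 \<or> n = 8 \<or> n = 10 \<or> n = 12 \<or> n = 14 \<or> n = 16"
    if "n \<noteq> 2 \<and> n \<noteq> 4" "3 \<le> m" "n + 2 * m = 22" for n m :: nat
    using that by presburger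
  ultimately show ?thesis using e by (metis insert_iff)
qed

end


section \<open>Order 11\<close>

text \<open>Subsets of \<open>\<int>/11\<close> are lists of truth values. \<open>search D n R\<close> tries to write \<open>R\<close> as a sum of the
  rotations of \<open>D\<close> by the elements of a subset of \<open>{..<n}\<close>, giving up as soon as an entry would become
  negative, so that the exhaustive check stays small enough for the simplifier.\<close>

fun combs :: "nat \<Rightarrow> nat \<Rightarrow> bool list list" where
  "combs 0 0 = [[]]"
| "combs 0 (Suc k) = []"
| "combs (Suc n) 0 = map (Cons False) (combs n 0)"
| "combs (Suc n) (Suc k) = map (Cons True) (combs n k) @ map (Cons False) (combs n (Suc k))"

fun sub_shift :: "bool list \<Rightarrow> nat list \<Rightarrow> nat list option" where
  "sub_shift (True # bs) (0 # rs) = None"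
| "sub_shift (True # bs) (Suc r # rs) = map_option (Cons r) (sub_shift bs rs)"
| "sub_shift (False # bs) (r # rs) = map_option (Cons r) (sub_shift bs rs)"
| "sub_shift _ _ = Some []"

fun search :: "bool list \<Rightarrow> nat \<Rightarrow> nat list \<Rightarrow> bool" where
  "search D 0 R = list_all (\<lambda>x. x = 0) R"
| "search D (Suc j) R =
    (if search (rotate1 D) j R then True
     else (case sub_shift D R of None \<Rightarrow> False | Some R' \<Rightarrow> search (rotate1 D) j R'))"

definition corr :: "bool list \<Rightarrow> bool list \<Rightarrow> nat \<Rightarrow> nat" where
  "corr x y k = length (filter (\<lambda>(u, v). u \<and> v) (zip (rotate k x) y))"

text \<open>The map i to -i on the cyclic group; correlating with a reflected list is convolving
  with the list.\<close>

definition refl_list :: "bool list \<Rightarrow> bool list" where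
  "refl_list x = hd x # rev (tl x)"

definition csum :: "bool list \<Rightarrow> nat list" where
  "csum c = map (\<lambda>k. corr c (refl_list c) k + (if c ! k then 1 else 0)) [0..<11]"

text \<open>What must be left for the sum of d and e is 6 - s at 0 and 4 - s elsewhere. It lies
  between 0 and 4, because d has 4 elements. The upper bounds on s also keep the natural subtraction
  in \<open>target\<close> from truncating.\<close>

definition bounded :: "nat list \<Rightarrow> bool" where
  "bounded s \<longleftrightarrow> 2 \<le> hd s \<and> hd s \<le> 6 \<and> list_all (\<lambda>x. x \<le> 4) (tl s)"

definition target :: "nat list \<Rightarrow> nat list" where
  "target s = (6 - hd s) # map (\<lambda>x. 4 - x) (tl s)"

definition refuted :: "bool list \<Rightarrow> bool" where
  "refuted c = (let s = csum c in
     if bounded s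
     then (let r = target s in list_all (\<lambda>d. \<not> search (True # d) 11 r) (combs 10 3))
     else True)"

lemma mem_combs: "length l = n \<Longrightarrow> length (filter id l) = k \<Longrightarrow> l \<in> set (combs n k)"
proof (induction n k arbitrary: l rule: combs.induct)
  case (3 n)
  obtain b bs where "l = b # bs" using 3(2) by (cases l) auto
  then show ?case using 3 by (auto split: if_splits)
next
  case (4 n k)
  obtain b bs where "l = b # bs" using 4(3) by (cases l) auto
  then show ?case using 4 by (auto split: if_splits)
qed auto

fun add_shift :: "bool list \<Rightarrow> nat list \<Rightarrow> nat list" where
  "add_shift (b # bs) (r # rs) = (if b then Suc r else r) # add_shift bs rs"
| "add_shift _ _ = []"

text \<open>Adds the rotations of D in the order in which \<open>search\<close> subtracts them, so
  that \<open>search_conv\<close> is a plain induction.\<close>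

fun conv :: "bool list \<Rightarrow> bool list \<Rightarrow> nat list" where
  "conv D [] = replicate (length D) 0"
| "conv D (e # es) = (if e then add_shift D (conv (rotate1 D) es) else conv (rotate1 D) es)"

lemma length_add_shift [simp]: "length D = length R \<Longrightarrow> length (add_shift D R) = length R"
  by (induction D R rule: add_shift.induct) auto

lemma length_conv [simp]: "length (conv D E) = length D"
  by (induction D E rule: conv.induct) auto

lemma sub_add_shift: "length D = length R \<Longrightarrow> sub_shift D (add_shift D R) = Some R"
proof (induction D R rule: list_induct2)
  case (Cons b bs r rs)
  then show ?case by (cases b) auto
qed auto

text \<open>Completeness of the search is what a refutation needs: an existing E is met on the
  branch that follows its entries.\<close>

lemma search_conv: "length E = n \<Longrightarrow> search D n (conv D E)"
proof (induction n arbitrary: D E)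
  case 0
  then show ?case by (simp add: list_all_iff)
next
  case (Suc n)
  then obtain e es where E: "E = e # es" "length es = n" by (cases E) auto
  show ?case using Suc.IH[OF E(2), of "rotate1 D"]
    by (auto simp: E sub_add_shift split: option.splits)
qed

lemma nth_add_shift: "length D = length R \<Longrightarrow> k < length R \<Longrightarrow>
    add_shift D R ! k = R ! k + of_bool (D ! k)"
proof (induction D R arbitrary: k rule: list_induct2)
  case (Cons b bs r rs)
  then show ?case by (cases k) auto
qed auto

lemma nth_conv: "k < length D \<Longrightarrow>
  conv D E ! k = (\<Sum>i<length E. of_bool (D ! ((k + i) mod length D) \<and> E ! i))"
proof (induction D E arbitrary: k rule: conv.induct)
  case (2 D e es)
  have "(\<Sum>i<length es. of_bool (rotate1 D ! ((k + i) mod length D) \<and> es ! i))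
      = (\<Sum>i<length es. of_bool (D ! ((k + Suc i) mod length D) \<and> es ! i) :: nat)"
  proof (rule sum.cong[OF refl])
    fix i
    have "(k + i) mod length D < length D" using 2(3) by (intro mod_less_divisor) auto
    then have "rotate1 D ! ((k + i) mod length D) = D ! (Suc ((k + i) mod length D) mod length D)"
      by (rule nth_rotate1)
    then show "of_bool (rotate1 D ! ((k + i) mod length D) \<and> es ! i)
        = (of_bool (D ! ((k + Suc i) mod length D) \<and> es ! i) :: nat)"
      by (simp add: mod_Suc_eq)
  qed
  then show ?case using 2
    by (auto simp: nth_add_shift sum.lessThan_Suc_shift simp del: sum.lessThan_Suc)
qed auto

lemma length_filter_sum: "length (filter P xs) = (\<Sum>i<length xs. of_bool (P (xs ! i)))"
  by (induction xs) (auto simp: sum.lessThan_Suc_shift simp del: sum.lessThan_Suc)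

lemma corr_sum: assumes "length y = length x"
  shows "corr x y k = (\<Sum>i<length x. of_bool (x ! ((k + i) mod length x) \<and> y ! i))"
  unfolding corr_def length_filter_sum using assms
  by (auto simp: nth_rotate intro!: sum.cong)

lemma nth_refl_list: assumes "i < length x"
  shows "refl_list x ! i = x ! ((length x - i) mod length x)"
proof (cases i)
  case 0
  then show ?thesis using assms by (simp add: refl_list_def hd_conv_nth)
next
  case (Suc j)
  then show ?thesis using assms by (simp add: refl_list_def rev_nth nth_tl Suc_diff_Suc)
qed

lemma length_refl_list: "x \<noteq> [] \<Longrightarrow> length (refl_list x) = length x"
  by (simp add: refl_list_def)

text \<open>The normalisation leaves 70 sets c, those with 5 elements that contain 1 but not 0 and
  10. Each is tested against at most the 120 sets d with 4 elements that contain 0.\<close>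

lemma all_refuted: "list_all (\<lambda>c. refuted (False # True # c @ [False])) (combs 8 4)"
  by code_simp


text \<open>Here \<open>c\<close> and \<open>d\<close> are the out-neighbours of a vertex in its own orbit and in the other one, and \<open>e\<close>
  the arcs back; the sums with \<open>c\<close> and \<open>c\<close>, and with \<open>d\<close> and \<open>e\<close>, count paths of length two. Up to
  replacing the automorphism by a power, 1 is in \<open>c\<close> and -1 is not.\<close>

lemma mod_11_system_unsolvable:
  fixes c d e :: "nat \<Rightarrow> bool"
  assumes c: "\<not> c 0" "c 1" "\<not> c 10" "(\<Sum>i<11. of_bool (c i)) = (5 :: nat)"
    and d: "d 0" "(\<Sum>i<11. of_bool (d i)) = (4 :: nat)"
    and eq: "\<And>k. k < 11 \<Longrightarrow>
      (\<Sum>i<11. of_bool (c ((k + i) mod 11) \<and> c ((11 - i) mod 11)))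
      + (\<Sum>i<11. of_bool (d ((k + i) mod 11) \<and> e i)) + of_bool (c k) = (if k = 0 then 6 else 4 :: nat)"
  shows False
proof -
  define cs ds es where "cs = map c [0..<11]" and "ds = map d [0..<11]" and "es = map e [0..<11]"
  have len: "length cs = 11" "length ds = 11" "length es = 11" by (simp_all add: cs_def ds_def es_def)
  have nth: "cs ! i = c i" "ds ! i = d i" "es ! i = e i" if "i < 11" for i
    using that by (simp_all add: cs_def ds_def es_def)
  have conv: "conv ds es ! k = (\<Sum>i<11. of_bool (d ((k + i) mod 11) \<and> e i))" if "k < 11" for k
    using nth_conv[of k ds es] that by (simp add: len nth)
  have "corr cs (refl_list cs) k = (\<Sum>i<11. of_bool (c ((k + i) mod 11) \<and> c ((11 - i) mod 11)))" for k
  proof -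
    have "cs \<noteq> []" using len(1) by auto
    then show ?thesis
      by (subst corr_sum) (auto simp: len nth nth_refl_list length_refl_list intro!: sum.cong)
  qed
  then have csum: "csum cs ! k + conv ds es ! k = (if k = 0 then 6 else 4)" if "k < 11" for k
    using eq[OF that] conv[OF that] that by (simp add: csum_def nth of_bool_def split: if_splits)
  have lcsum: "length (csum cs) = 11" by (simp add: csum_def)
  have conv_le: "conv ds es ! k \<le> 4" if "k < 11" for k
  proof -
    have "conv ds es ! k \<le> (\<Sum>i<11. of_bool (d ((k + i) mod 11)))"
      unfolding conv[OF that] by (intro sum_mono) auto
    also have "bij_betw (\<lambda>i. (k + i) mod 11) {..<11} {..<11}"
    proof (rule bij_betwI[where g = "\<lambda>i. (i + (11 - k)) mod 11"])
      show "((k + x) mod 11 + (11 - k)) mod 11 = x" if "x \<in> {..<11}" for x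
      proof -
        have "((k + x) mod 11 + (11 - k)) mod 11 = (k + x + (11 - k)) mod 11" by (rule mod_add_left_eq)
        also have "k + x + (11 - k) = x + 11" using \<open>k < 11\<close> by simp
        finally show ?thesis using that by simp
      qed
      show "(k + (y + (11 - k)) mod 11) mod 11 = y" if "y \<in> {..<11}" for y
      proof -
        have "(k + (y + (11 - k)) mod 11) mod 11 = (k + (y + (11 - k))) mod 11" by (rule mod_add_right_eq)
        also have "k + (y + (11 - k)) = y + 11" using \<open>k < 11\<close> by simp
        finally show ?thesis using that by simp
      qed
    qed auto
    then have "(\<Sum>i<11. of_bool (d ((k + i) mod 11))) = (\<Sum>i<11. of_bool (d i) :: nat)"
      by (rule sum.reindex_bij_betw)
    finally show ?thesis using d(2) by simp
  qed
  have ne: "csum cs \<noteq> []" using lcsum by auto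
  have hd: "hd (csum cs) = csum cs ! 0" using ne by (rule hd_conv_nth)
  have tl: "tl (csum cs) ! i = csum cs ! Suc i" if "i < 10" for i
    using that lcsum by (simp add: nth_tl)
  have "bounded (csum cs)"
    using csum[of 0] conv_le[of 0] csum[of "Suc _"] lcsum
    by (fastforce simp: bounded_def hd list_all_length tl)
  moreover have "target (csum cs) = conv ds es"
  proof (rule nth_equalityI)
    show "length (target (csum cs)) = length (conv ds es)" by (simp add: target_def len lcsum)
    fix k assume "k < length (target (csum cs))"
    then have k: "k < 11" by (simp add: target_def lcsum)
    show "target (csum cs) ! k = conv ds es ! k"
      using csum[OF k] k by (cases k) (auto simp: target_def hd tl lcsum)
  qed
  moreover have "search ds 11 (conv ds es)" using search_conv[of es 11 ds] len by simp
  moreover have ds: "ds = True # map d [1..<11]" using d(1) by (simp add: ds_def upt_conv_Cons)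
  moreover have "map d [1..<11] \<in> set (combs 10 3)"
  proof (rule mem_combs)
    have ext: "length (filter id (True # l)) = Suc (length (filter id l))" for l by simp
    have "length (filter id ds) = 4" unfolding length_filter_sum using d(2) by (simp add: len nth)
    then show "length (filter id (map d [1..<11])) = 3" unfolding ds ext by linarith
  qed simp
  moreover have cs: "cs = False # True # map c [2..<10] @ [False]"
    using c(1-3) by (simp add: cs_def upt_rec eval_nat_numeral)
  moreover have "map c [2..<10] \<in> set (combs 8 4)"
  proof (rule mem_combs)
    have ext: "length (filter id (False # True # l @ [False])) = Suc (length (filter id l))" for l
      by simp
    have "length (filter id cs) = 5" unfolding length_filter_sum using c(4) by (simp add: len nth)
    then show "length (filter id (map c [2..<10])) = 4" unfolding cs ext by linarith
  qed simp
  ultimately show False using all_refuted by (auto simp: list_all_iff refuted_def Let_def)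
qed


section \<open>Order 11 without fixed points; conclusion on the order\<close>

context cyc_aut
begin

lemma orb_shift_pow: "(\<Sum>y\<in>orb x. g ((r ^^ k) y)) = (\<Sum>y\<in>orb x. g y)"
proof (induction k arbitrary: g)
  case (Suc k)
  then show ?case using Suc.IH[of "\<lambda>z. g (r z)"] orb_shift[of g x] by simp
qed simp

lemma rpow_inv: assumes "x \<in> V" "y \<in> V" shows "a ((r ^^ i) x) ((r ^^ i) y) = a x y"
  by (induction i) (auto simp: assms inv rpowV)

text \<open>Two orbits and degree 9 leave one unknown s = \<open>S s s\<close>, subject to s^2 + (9
  - s)^2 = 46 - s, whose roots are 5 and 7/2.\<close>

lemma orbit_out_degree_order_11: assumes "p = 11" "F = {}" "x \<in> V" shows "S x x = 5"
proof -
  obtain s where s: "s \<in> T" "x \<in> orb s" using V_decomp assms by blast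
  have "card T = 2" using card_eq assms by simp
  then have "card (T - {s}) = 1" using s(1) by simp
  then obtain u where "T - {s} = {u}" by (rule card_1_singletonE)
  then have T: "T = {s, u}" "u \<noteq> s" using s(1) by auto
  have 1: "S s s + S s u = 9" using row_T[OF s(1)] T assms by simp
  have 2: "S s s + S u s = 9"
    using colsum[OF TV[OF s(1)]] V_sum[of "\<lambda>z. a z s"] S_col[of _ s] T assms by simp
  have "S s s * S s s + S s u * S u s = 46 - S s s"
    using sq_TT[OF s(1) s(1)] T assms by simp
  moreover have "S s u = 9 - S s s" "S u s = 9 - S s s" using 1 2 by auto
  ultimately have "(2 * S s s - 7) * (S s s - 5) = 0" by (simp add: algebra_simps)
  moreover have "2 * S s s \<noteq> 7" by presburger
  ultimately have "S s s = 5" by simp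
  then show ?thesis using S_const[OF TV[OF s(1)] TV[OF s(1)] s(2)] orb_eq[OF s(2)]
    unfolding S_def by simp
qed

lemma order_11_no_one_way_arc:
  assumes p: "p = 11" and F: "F = {}" and t: "t \<in> V" and c1: "a t (r t) = 1" and c10: "a t ((r ^^ 10) t) = 0"
  shows False
proof -
  have mv: "r x \<noteq> x" if "x \<in> V" for x using F that unfolding F_def by auto
  have osum: "(\<Sum>z\<in>orb x. g z) = (\<Sum>i<11. g ((r ^^ (k + i)) x))" if "x \<in> V" for x k g
    using orb_shift_pow[of g k x] orb_sum[OF mv[OF that], of "\<lambda>z. g ((r ^^ k) z)"] p
    by (simp add: funpow_add)
  have osum0: "(\<Sum>z\<in>orb x. g z) = (\<Sum>i<11. g ((r ^^ i) x))" if "x \<in> V" for x g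
    using osum[OF that, of g 0] by simp
  have St: "(\<Sum>z\<in>orb t. a t z) = 5" using orbit_out_degree_order_11[OF p F t] unfolding S_def .
  have "(\<Sum>z\<in>V. a t z) = (\<Sum>z\<in>orb t. a t z) + (\<Sum>z\<in>V - orb t. a t z)"
    using sum.subset_diff[OF orbV[OF t] finV, of "a t"] by (simp add: add.commute)
  then have S4: "(\<Sum>z\<in>V - orb t. a t z) = 4" using rowsum[OF t] St by simp
  \<comment> \<open>The base point of the second orbit is taken among the out-neighbours of t, so
    that 0 belongs to d.\<close>
  then obtain y where y: "y \<in> V - orb t" "a t y = 1"
    by (metis a01 sum.neutral zero_neq_numeral)
  have yV: "y \<in> V" using y by auto
  have "orb y \<inter> orb t = {}" using y orb_eq orb_self by (metis DiffD2 disjoint_iff)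
  then have "orb y \<subseteq> V - orb t" using orbV yV by auto
  moreover have "card (V - orb t) = card (orb y)"
    using card_Diff_subset[OF fin_orb orbV[OF t]] card_orb mv t yV cardV p by simp
  ultimately have Vy: "V - orb t = orb y" using finV by (metis card_subset_eq finite_Diff)
  have Vsum: "(\<Sum>z\<in>V. g z) = (\<Sum>z\<in>orb t. g z) + (\<Sum>z\<in>orb y. g z)" for g :: "'a \<Rightarrow> int"
    using sum.subset_diff[OF orbV[OF t] finV, of g] Vy by (simp add: add.commute)
  define c d e where "c i \<longleftrightarrow> a t ((r ^^ i) t) = 1" and "d i \<longleftrightarrow> a t ((r ^^ i) y) = 1"
    and "e i \<longleftrightarrow> a ((r ^^ i) y) t = 1" for i
  have ab: "a u v = of_bool (a u v = 1)" for u v using a01[of u v] by auto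
  have modr: "(r ^^ (m mod 11)) x = (r ^^ m) x" for m x using rpow_mod[of m x] p by simp
  show False
  proof (rule mod_11_system_unsolvable[of c d e])
    show "\<not> c 0" "c 1" "\<not> c 10" "d 0" using noloop[OF t] c1 c10 y(2) by (auto simp: c_def d_def)
    have "int (\<Sum>i<11. of_bool (c i)) = (\<Sum>z\<in>orb t. a t z)"
      unfolding osum0[OF t] c_def of_nat_sum of_nat_of_bool by (intro sum.cong ab[symmetric] refl)
    then show "(\<Sum>i<11. of_bool (c i)) = (5 :: nat)" using St by linarith
    have "int (\<Sum>i<11. of_bool (d i)) = (\<Sum>z\<in>orb y. a t z)"
      unfolding osum0[OF yV] d_def of_nat_sum of_nat_of_bool by (intro sum.cong ab[symmetric] refl)
    then show "(\<Sum>i<11. of_bool (d i)) = (4 :: nat)" using S4 unfolding Vy by linarith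
    fix k :: nat assume k: "k < 11"
    let ?w = "(r ^^ k) t"
    have 1: "(\<Sum>z\<in>orb t. a t z * a z ?w)
        = int (\<Sum>i<11. of_bool (c ((k + i) mod 11) \<and> c ((11 - i) mod 11)))"
      unfolding osum[OF t, of _ k] of_nat_sum of_nat_of_bool
    proof (rule sum.cong[OF refl])
      fix i :: nat assume i: "i \<in> {..<11}"
      have "a ((r ^^ (k + i)) t) ?w = a ((r ^^ i) t) t"
        unfolding funpow_add comp_apply by (intro rpow_inv rpowV t)
      \<comment> \<open>Rotating by 11 - i expresses arcs back to t through the out-arcs of t; this
        is the reflection of c.\<close>
      also have "\<dots> = a ((r ^^ i) t) ((r ^^ i) ((r ^^ (11 - i)) t))"
        using rp[of t] p i by (simp flip: comp_apply[of "r ^^ i"] funpow_add)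
      also have "\<dots> = a t ((r ^^ (11 - i)) t)" by (intro rpow_inv rpowV t)
      finally have "a ((r ^^ (k + i)) t) ?w = of_bool (c ((11 - i) mod 11))"
        using ab[of t "(r ^^ (11 - i)) t"] unfolding c_def modr by simp
      moreover have "a t ((r ^^ (k + i)) t) = of_bool (c ((k + i) mod 11))"
        using ab[of t "(r ^^ (k + i)) t"] unfolding c_def modr by simp
      ultimately show "a t ((r ^^ (k + i)) t) * a ((r ^^ (k + i)) t) ?w =
          of_bool (c ((k + i) mod 11) \<and> c ((11 - i) mod 11))" by (simp only: of_bool_conj)
    qed
    have 2: "(\<Sum>z\<in>orb y. a t z * a z ?w)
        = int (\<Sum>i<11. of_bool (d ((k + i) mod 11) \<and> e i))"
      unfolding osum[OF yV, of _ k] of_nat_sum of_nat_of_bool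
    proof (rule sum.cong[OF refl])
      fix i :: nat assume i: "i \<in> {..<11}"
      have "a ((r ^^ (k + i)) y) ?w = a ((r ^^ i) y) t"
        unfolding funpow_add comp_apply by (intro rpow_inv rpowV t yV)
      then have "a ((r ^^ (k + i)) y) ?w = of_bool (e i)"
        using ab[of "(r ^^ i) y" t] unfolding e_def by simp
      moreover have "a t ((r ^^ (k + i)) y) = of_bool (d ((k + i) mod 11))"
        using ab[of t "(r ^^ (k + i)) y"] unfolding d_def modr by simp
      ultimately show "a t ((r ^^ (k + i)) y) * a ((r ^^ (k + i)) y) ?w =
          of_bool (d ((k + i) mod 11) \<and> e i)" by (simp only: of_bool_conj)
    qed
    have 3: "a t ?w = int (of_bool (c k))" using ab[of t ?w] unfolding c_def by simp
    have "t = ?w \<longleftrightarrow> k = 0"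
      using rpow_fix[of k t] mv[OF t] k p by (cases "k = 0") auto
    then have "int (\<Sum>i<11. of_bool (c ((k + i) mod 11) \<and> c ((11 - i) mod 11)))
      + int (\<Sum>i<11. of_bool (d ((k + i) mod 11) \<and> e i)) + int (of_bool (c k)) = (if k = 0 then 6 else 4)"
      using sq[OF t rpowV[OF t, of k]] Vsum[of "\<lambda>z. a t z * a z ?w"] 1 2 3 by simp
    then have "int ((\<Sum>i<11. of_bool (c ((k + i) mod 11) \<and> c ((11 - i) mod 11)))
      + (\<Sum>i<11. of_bool (d ((k + i) mod 11) \<and> e i)) + of_bool (c k)) = int (if k = 0 then 6 else 4)"
      by (cases "k = 0") (simp_all only: of_nat_add if_True if_False refl of_nat_numeral)
    then show "(\<Sum>i<11. of_bool (c ((k + i) mod 11) \<and> c ((11 - i) mod 11)))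
      + (\<Sum>i<11. of_bool (d ((k + i) mod 11) \<and> e i)) + of_bool (c k) = (if k = 0 then 6 else 4 :: nat)"
      by (simp only: of_nat_eq_iff)
  qed
qed

text \<open>Serves to relabel an orbit: an arc from t to r^u t becomes one with exponent 1.\<close>

lemma power_aut: assumes "0 < u" "u < p" shows "cyc_aut V a (r ^^ u) p"
proof -
  obtain x where x: "x \<in> V" "r x \<noteq> x" using moved by auto
  have "((r ^^ u) ^^ p) z = z" for z
    using rpow_mod[of "u * p" z] by (simp add: funpow_mult mult.commute)
  moreover have "(r ^^ u) x \<noteq> x" using rpow_fix[OF _ assms, of x] x by auto
  moreover have "(r ^^ u) permutes V" using rV by (induction u) (auto simp: permutes_compose permutes_id[unfolded id_def] id_def[symmetric] permutes_id)
  ultimately show ?thesis using x finV cardV a01 noloop rowsum colsum sq rpow_inv pp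
    by unfold_locales auto
qed

text \<open>The out-neighbours of t in its own orbit are 5 in number. As 5 is odd, their exponents
  are not closed under negation, so some u is among them and -u is not. Passing to r^u turns these
  exponents into 1 and 10.\<close>

lemma order_11_fixed_points: assumes "p = 11" shows "F \<noteq> {}"
proof
  assume F: "F = {}"
  obtain t where t: "t \<in> V" "r t \<noteq> t" using moved by auto
  have "\<exists>u. 0 < u \<and> u < 11 \<and> a t ((r ^^ u) t) = 1 \<and> a t ((r ^^ (11 - u)) t) = 0"
  proof (rule ccontr)
    assume "\<not> ?thesis"
    then have le: "a t ((r ^^ u) t) \<le> a t ((r ^^ (11 - u)) t)" if "0 < u" "u < 11" for u
      using that a01[of t "(r ^^ u) t"] a01[of t "(r ^^ (11 - u)) t"] by auto
    have *: "a t ((r ^^ u) t) = a t ((r ^^ (11 - u)) t)" if "0 < u" "u < 11" for u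
      using le[of u] le[of "11 - u"] that by simp
    have "5 = (\<Sum>i<11. a t ((r ^^ i) t))"
      using orbit_out_degree_order_11[OF assms F t(1)] orb_sum[OF t(2), of "a t"] assms unfolding S_def by simp
    also have "{..<11} = {0, 1, 2, 3, 4, 5, 6, 7, 8, 9, 10 :: nat}"
      by (auto simp: eval_nat_numeral less_Suc_eq)
    finally have "5 = 2 * (a t ((r ^^ 1) t) + a t ((r ^^ 2) t) + a t ((r ^^ 3) t) + a t ((r ^^ 4) t)
      + a t ((r ^^ 5) t))"
      using *[of 1] *[of 2] *[of 3] *[of 4] *[of 5] noloop[OF t(1)] by (simp add: algebra_simps)
    then show False by presburger
  qed
  then obtain u where u: "0 < u" "u < 11" "a t ((r ^^ u) t) = 1" "a t ((r ^^ (11 - u)) t) = 0" by auto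
  interpret pow: cyc_aut V a "r ^^ u" p
    by (rule power_aut) (use u(1,2) assms in simp_all)
  have "pow.F = {}"
    using F rpow_fix[of u] u assms unfolding pow.F_def F_def by auto
  moreover have "((r ^^ u) ^^ 10) t = (r ^^ (11 - u)) t"
  proof -
    have "((r ^^ u) ^^ 10) t = (r ^^ ((10 * u) mod 11)) t"
      using rpow_mod[of "10 * u" t] assms by (simp add: funpow_mult mult.commute)
    also have "10 * u = (11 - u) + 11 * (u - 1)" using u(1,2) by simp
    also have "\<dots> mod 11 = 11 - u" using u(1) by (simp only: mod_mult_self2) simp
    finally show ?thesis .
  qed
  ultimately show False using pow.order_11_no_one_way_arc[OF assms _ t(1)] u by simp
qed

lemma order_2_or_3: "p = 2 \<or> p = 3"
proof (rule ccontr)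
  assume n: "\<not> ?thesis"
  have "p \<noteq> 4" "p \<noteq> 6" "p > 1"
    using pp prime_gt_1_nat by (auto simp: prime_nat_iff dest: spec[of _ "2 :: nat"])
  then have p7: "p \<ge> 7" using n order_not_5 by linarith
  then have F: "F = {}" by (rule large_order_no_fixed_points)
  then have "2 * 11 = p * card T" using card_eq by simp
  then have "p dvd 2 * 11" by (rule dvdI)
  then have "p dvd 2 \<or> p dvd 11" using pp prime_dvd_mult_iff by blast
  moreover have "\<not> p dvd 2" using p7 by (auto dest: dvd_imp_le)
  moreover have "prime (11 :: nat)" by (simp add: prime_nat_numeral_eq)
  ultimately have "p = 11" using pp primes_dvd_imp_eq by blast
  then show False using order_11_fixed_points F by simp
qed

end


section \<open>Order 3\<close>

locale cyc_aut3 = cyc_aut +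
  assumes p3: "p = 3"
begin

lemma dual3: "cyc_aut3 V (\<lambda>x y. a y x) r p"
  using dual p3 by (simp add: cyc_aut3_def cyc_aut3_axioms_def)

lemma dual_S: "t \<in> T \<Longrightarrow> s \<in> T \<Longrightarrow> cyc_aut.S (\<lambda>x y. a y x) r p t s = S s t"
  using S_col[of s t] unfolding cyc_aut.S_def[OF dual] by simp

definition L where "L x y = (\<Sum>t\<in>T. a x t * a t y)"

lemma L_ge0: "0 \<le> L x y" unfolding L_def by (rule TT_ge0)

lemma b_row: "x \<in> F \<Longrightarrow> b x + 3 * (\<Sum>t\<in>T. a x t) = 9"
  using row_F p3 unfolding b_def by simp

lemma b_col: "x \<in> F \<Longrightarrow> (\<Sum>y\<in>F. a y x) + 3 * (\<Sum>t\<in>T. a t x) = 9"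
  using cyc_aut3.b_row[OF dual3, of x] unfolding cyc_aut.b_def[OF dual] .

lemma P_L: "x \<in> F \<Longrightarrow> y \<in> F \<Longrightarrow> P x y + 3 * L x y = 4 - a x y + (if x = y then 2 else 0)"
  using sq_FF[of x y] p3 unfolding P_def L_def by simp

lemma P_le: assumes "y \<in> F" shows "P x y \<le> b x - a x y"
proof -
  have "P x y = (\<Sum>z\<in>F - {y}. a x z * a z y)"
    unfolding P_def using assms noloop FV by (simp add: sum.remove[of F y] subsetD)
  also have "\<dots> \<le> (\<Sum>z\<in>F - {y}. a x z)"
    by (intro sum_mono) (metis a_ge0 a_le1 mult.right_neutral mult_left_mono)
  also have "\<dots> = b x - a x y" unfolding b_def using assms by (simp add: sum.remove[of F y])
  finally show ?thesis .
qed

text \<open>By \<open>b_row\<close>, \<open>b x\<close> is divisible by 3. If it were 0, all 4 paths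
  to another fixed vertex would run through orbits, and these come in threes.\<close>

lemma b_cases: assumes "card F \<ge> 2" "x \<in> F" shows "b x = 3 \<or> b x = 6 \<or> b x = 9"
proof -
  have "0 \<le> b x" unfolding b_def by (intro sum_nonneg a_ge0)
  moreover have "0 \<le> (\<Sum>t\<in>T. a x t)" by (intro sum_nonneg a_ge0)
  moreover have "b x \<noteq> 0"
  proof
    assume 0: "b x = 0"
    have "\<not> F \<subseteq> {x}" using assms card_mono[of "{x}" F] by auto
    then obtain y where y: "y \<in> F" "y \<noteq> x" by auto
    have "P x y = 0" "a x y = 0" using P_le[OF y(1), of x] 0 P_ge0[of x y] a_ge0[of x y] by auto
    then have "3 * L x y = 4" using P_L[OF assms(2) y(1)] y by simp
    then show False by presburger
  qed
  ultimately show ?thesis using b_row[OF assms(2)] by presburger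
qed

text \<open>If x were joined to all of F, the paths from x to y inside F would number one less than
  the in-degree of y from F, hence 2 modulo 3 by \<open>b_col\<close>; the path equation over an arc
  requires 0 modulo 3.\<close>

lemma b_ne: assumes "card F \<ge> 2" "x \<in> F" shows "b x \<noteq> int (card F) - 1"
proof
  assume b: "b x = int (card F) - 1"
  have "\<not> F \<subseteq> {x}" using assms card_mono[of "{x}" F] by auto
  then obtain y where y: "y \<in> F" "y \<noteq> x" by auto
  have one: "a x z = 1" if z: "z \<in> F" "z \<noteq> x" for z
  proof (rule ccontr)
    assume "a x z \<noteq> 1"
    then have "a x z = 0" using a01[of x z] by simp
    then have "b x = (\<Sum>u\<in>F - {x, z}. a x u)" unfolding b_def
      using noloop assms FV z by (intro sum.mono_neutral_right) auto
    also have "\<dots> \<le> card (F - {x, z})" using sum_bounded_above[of "F - {x, z}" "a x" 1] a_le1 by simp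
    also have "card (F - {x, z}) = card F - 2" using z assms by (subst card_Diff_subset) auto
    finally show False using b assms by simp
  qed
  have "P x y = (\<Sum>z\<in>F - {x}. a z y)" unfolding P_def
    using one noloop assms FV by (simp add: sum.remove[of F x] subsetD)
  also have "\<dots> = (\<Sum>z\<in>F. a z y) - 1" using assms one[OF y] by (simp add: sum.remove[of F x])
  finally have "3 * ((\<Sum>t\<in>T. a t y) - L x y) = 5"
    using P_L[OF assms(2) y(1)] y(2) one[OF y] b_col[OF y(1)] by simp
  then show False by presburger
qed

text \<open>The count is 1 - \<open>a x y\<close> modulo 3, and \<open>P_le\<close> leaves no room
  for adding 3.\<close>

lemma P_if_b3: assumes "x \<in> F" "b x = 3" "y \<in> F" "y \<noteq> x"
  shows "P x y = 1 - a x y"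
  using P_L[OF assms(1,3)] P_le[OF assms(3), of x] P_ge0[of x y] L_ge0[of x y] a01[of x y] assms
  by (elim disjE) (simp_all, presburger+)

lemma b3_sum: assumes "x \<in> F" "b x = 3"
  shows "(\<Sum>z\<in>F. a x z * b z) = P x x + int (card F) - 4" "P x x = 0 \<or> P x x = 3"
proof -
  have "(\<Sum>y\<in>F. P x y) = P x x + 1 * (int (card F) - 1) - 1 * b x"
    by (rule P_sum_split) (use P_if_b3 assms in auto)
  then show "(\<Sum>z\<in>F. a x z * b z) = P x x + int (card F) - 4" using P_sum assms by simp
  show "P x x = 0 \<or> P x x = 3"
  proof -
    have "a x x = 0" using noloop assms FV by auto
    then have "P x x + 3 * L x x = 6" using P_L[OF assms(1,1)] by simp
    then show ?thesis using P_le_b[of x x] assms(2) P_ge0[of x x] by presburger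
  qed
qed

lemma sum_const: assumes "\<And>z. z \<in> F \<Longrightarrow> b z = c" shows "(\<Sum>z\<in>F. a x z * b z) = c * b x"
  using assms unfolding b_def[of x] by (simp add: sum_distrib_left mult.commute)

text \<open>With 4 fixed points no value of b survives \<open>b_ne\<close>. With 7 only 3 does, and
  then \<open>b3_sum\<close> would equate 9 with 3 or 6.\<close>

lemma card_F_not_4_7: "card F \<noteq> 4" "card F \<noteq> 7"
proof -
  show "card F \<noteq> 4"
  proof
    assume f: "card F = 4"
    then obtain x where x: "x \<in> F" by fastforce
    show False using b_cases[OF _ x] b_le[OF x] b_ne[OF _ x] f by simp
  qed
  show "card F \<noteq> 7"
  proof
    assume f: "card F = 7"
    then obtain x where x: "x \<in> F" by fastforce
    have "b z = 3" if "z \<in> F" for z using b_cases[OF _ that] b_le[OF that] b_ne[OF _ that] f by auto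
    then show False using b3_sum[OF x] sum_const[of 3 x] f x by auto
  qed
qed

text \<open>When \<open>b x\<close> = 3, the values of b at the out-neighbours of x in F sum to at
  most 9, so each is 3. By \<open>P_if_b3\<close> every other fixed vertex is reached from x within
  F in at most two steps, so the value 3 spreads to all of F.\<close>

lemma F10_regular: assumes f: "card F = 10"
  shows "(\<forall>x\<in>F. b x = 3) \<or> (\<forall>x\<in>F. b x = 6)"
proof -
  have c: "b x = 3 \<or> b x = 6" if "x \<in> F" for x using b_cases[OF _ that] b_ne[OF _ that] f by auto
  have nb: "b z = 3" if x: "x \<in> F" "b x = 3" and z: "z \<in> F" "a x z = 1" for x z
  proof (rule ccontr)
    assume "b z \<noteq> 3"
    then have bz: "b z = 6" using c z by auto
    have "(\<Sum>z\<in>F - {z}. 3 * a x z) \<le> (\<Sum>z\<in>F - {z}. a x z * b z)"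
    proof (rule sum_mono)
      fix u assume "u \<in> F - {z}"
      then show "3 * a x u \<le> a x u * b u" using c[of u] a01[of x u] by auto
    qed
    moreover have "b x = a x z + (\<Sum>z\<in>F - {z}. a x z)" unfolding b_def using z by (simp add: sum.remove)
    moreover have "(\<Sum>z\<in>F. a x z * b z) = a x z * b z + (\<Sum>z\<in>F - {z}. a x z * b z)"
      using z by (simp add: sum.remove)
    moreover have "(\<Sum>z\<in>F - {z}. 3 * a x z) = 3 * (\<Sum>z\<in>F - {z}. a x z)"
      by (rule sum_distrib_left[symmetric])
    moreover have "a x z * b z = 6" using bz z by simp
    moreover have "(\<Sum>z\<in>F. a x z * b z) \<le> 9" using b3_sum[OF x] f by auto
    ultimately show False using x(2) z(2) by linarith
  qed
  have "b y = 3" if x: "x \<in> F" "b x = 3" and y: "y \<in> F" for x y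
  proof (cases "y = x \<or> a x y = 1")
    case True
    then show ?thesis using nb[OF x y] x by auto
  next
    case False
    then have "P x y \<noteq> 0" using P_if_b3[OF x y] a01[of x y] by auto
    then obtain z where z: "z \<in> F" "a x z * a z y \<noteq> 0" unfolding P_def by (meson sum.not_neutral_contains_not_neutral)
    then have "a x z = 1" "a z y = 1" using a01[of x z] a01[of z y] by auto
    then show ?thesis using nb[OF x z(1)] nb[OF z(1) _ y] by simp
  qed
  then show ?thesis using c by blast
qed

lemma F_sym: assumes "x \<in> F" "P x x = b x" "z \<in> F" shows "a x z \<le> a z x"
proof -
  have "(\<Sum>z\<in>F. a x z * (1 - a z x)) = 0"
    using assms(2) unfolding P_def b_def by (simp add: right_diff_distrib sum_subtractf)
  moreover have "0 \<le> a x z * (1 - a z x)" for z using a_ge0[of x z] a_le1[of z x] by simp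
  ultimately have "a x z * (1 - a z x) = 0" using assms(3) by (subst (asm) sum_nonneg_eq_0_iff) auto
  then show ?thesis using a_ge0[of z x] a_le1[of x z] by auto
qed

text \<open>Summing the path equation over \<open>F\<close> shows that there are no paths of length two through the orbits
  between fixed vertices; then 4 would be an entry of the quotient matrix, which is at most 3.\<close>

lemma F10_not_6_regular: assumes f: "card F = 10" shows "\<not> (\<forall>x\<in>F. b x = 6)"
proof
  assume b6: "\<forall>x\<in>F. b x = 6"
  have L0: "L x y = 0" if x: "x \<in> F" and y: "y \<in> F" for x y
  proof -
    have "(\<Sum>y\<in>F. P x y + 3 * L x y) = (\<Sum>y\<in>F. 4 - a x y + (if x = y then 2 else 0))"
      using P_L[OF x] by (intro sum.cong) auto
    also have "\<dots> = 36" using x f b6 unfolding b_def by (simp add: sum.distrib sum_subtractf)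
    finally have "(\<Sum>y\<in>F. P x y) + 3 * (\<Sum>y\<in>F. L x y) = 36"
      by (simp add: sum.distrib sum_distrib_left)
    moreover have "(\<Sum>y\<in>F. P x y) = 36" using P_sum[of x] sum_const[of 6 x] b6 x by simp
    ultimately have "(\<Sum>y\<in>F. L x y) = 0" by simp
    then show ?thesis using y by (subst (asm) sum_nonneg_eq_0_iff) (auto simp: L_ge0)
  qed
  have sym: "a x z = a z x" if "x \<in> F" "z \<in> F" for x z
  proof -
    have "P u u = b u" if "u \<in> F" for u
      using P_L[OF that that] L0[OF that that] noloop[of u] FV b6 that by auto
    then show ?thesis using F_sym[of x z] F_sym[of z x] that by simp
  qed
  obtain x where x: "x \<in> F" using f by fastforce
  have "(\<Sum>t\<in>T. a x t) = 1" using b_row[OF x] b6 x by simp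
  then obtain t where t: "t \<in> T" "a x t = 1" by (metis a01 sum.neutral zero_neq_one)
  have at: "a t y = 0" if y: "y \<in> F" for y
  proof -
    have "a x t * a t y \<le> L x y" unfolding L_def using t
      by (intro member_le_sum mult_nonneg_nonneg a_ge0) auto
    then show ?thesis using t L0[OF x y] a_ge0[of t y] by auto
  qed
  have "(\<Sum>s\<in>T. S t s * a s x) = 4" using sq_TF[OF x t(1)] at x by simp
  moreover have "(\<Sum>s\<in>T. S t s * a s x) \<le> (\<Sum>s\<in>T. 3 * a s x)"
    by (intro sum_mono mult_right_mono a_ge0) (use S_le p3 in fastforce)
  moreover have "(\<Sum>y\<in>F. a y x) = b x" unfolding b_def using sym x by (intro sum.cong) auto
  then have "(\<Sum>s\<in>T. a s x) = 1" using b_col[OF x] b6 x by simp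
  ultimately show False by (simp add: sum_distrib_left[symmetric])
qed

end


section \<open>Extremal entries of the quotient matrix for order 3\<close>

context cyc_aut3
begin

lemma W_le_0: assumes "t \<in> T" "q \<in> T" "S t q = 0 \<or> S t q = 3 \<or> S q t = 0 \<or> S q t = 3"
  shows "W t q \<le> 0"
proof -
  have "W t q \<le> S t q * (3 - S q t)" "W t q \<le> S q t * (3 - S t q)"
    using W_bounds_3(2,3)[OF p3 assms(1,2)] by (simp_all add: algebra_simps)
  then show ?thesis using assms(3) by auto
qed

lemma W_eq_2: assumes "t \<in> T" "q \<in> T" "W t q \<ge> 2"
  shows "(S t q = 1 \<and> S q t = 1) \<or> (S t q = 2 \<and> S q t = 2)"
proof -
  have b: "W t q \<le> S t q * (3 - S q t)" "W t q \<le> S q t * (3 - S t q)"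
    using W_bounds_3(2,3)[OF p3 assms(1,2)] by (simp_all add: algebra_simps)
  have "S t q \<in> {0, 1, 2, 3}" "S q t \<in> {0, 1, 2, 3}" using W_bounds_3(4)[OF p3] assms by auto
  then show ?thesis using b assms(3) by auto
qed

lemma sq_TT3: "t \<in> T \<Longrightarrow> u \<in> T \<Longrightarrow>
    3 * (\<Sum>z\<in>F. a t z * a z u) + (\<Sum>s\<in>T. S t s * S s u) = 12 - S t u + (if t = u then 2 else 0)"
  using sq_TT[of t u] unfolding arg_cong[OF p3, of int] by simp

lemma W_le_2: "t \<in> T \<Longrightarrow> q \<in> T \<Longrightarrow> W t q \<le> 2" using W_bounds_3(1)[OF p3] .

end

section \<open>Order 3 with 10 fixed points\<close>

locale four_orbits = cyc_aut3 +
  fixes t1 t2 t3 t4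
  assumes T: "T = {t1, t2, t3, t4}" and dist: "distinct [t1, t2, t3, t4]"
begin

lemma inT: "t1 \<in> T" "t2 \<in> T" "t3 \<in> T" "t4 \<in> T" using T by auto

lemma Tsum: "(\<Sum>t\<in>T. g t) = g t1 + g t2 + g t3 + g t4" for g :: "'a \<Rightarrow> int"
  using T dist by simp

lemma W4: "t \<in> T \<Longrightarrow> W t t1 + W t t2 + W t t3 + W t t4 = 4 + S t t"
  using W_sum[of t] Tsum[of "W t"] p3 by simp

lemma swap34: "four_orbits V a r p t1 t2 t4 t3"
  by unfold_locales (use T dist in auto)

lemma swap_pairs: "four_orbits V a r p t3 t4 t1 t2"
  by unfold_locales (use T dist in auto)

text \<open>The digits are the values y and w of \<open>class_degree_equation\<close>. A diagonal
  entry 1 makes the row sum of \<open>W\<close> too small, so the two diagonal blocks have zeros on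
  and ones off the diagonal. The quadratic equations at (t1, t3) and (t1, t4) then make
  \<open>S t1 t4\<close> and \<open>S t1 t3\<close> divisible by 3, which leaves only
  \<open>W t1 t2\<close> positive in the first row.\<close>

lemma quotient_22_impossible:
  assumes s: "S t1 t1 + S t2 t1 = 1" "S t1 t2 + S t2 t2 = 1" "S t1 t3 + S t2 t3 = 3" "S t1 t4 + S t2 t4 = 3"
    "S t3 t3 + S t4 t3 = 1" "S t3 t4 + S t4 t4 = 1" "S t3 t1 + S t4 t1 = 3" "S t3 t2 + S t4 t2 = 3"
  shows False
proof -
  have z: "S t t = 0" if t: "t \<in> T" "u \<in> T" "S t t + S u t = 1" "{t, u} = {t1, t2} \<or> {t, u} = {t3, t4}" for t u
  proof (rule ccontr)
    assume "S t t \<noteq> 0"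
    then have 1: "S t t = 1" "S u t = 0" using S_ge0[of t t] S_ge0[of u t] t(3) by auto
    have "W t u \<le> 0" by (rule W_le_0) (use 1 t in auto)
    moreover have "W t t = -1" using W_diag_3[OF p3 t(1)] 1 by simp
    ultimately show False using W4[OF t(1)] 1 W_le_2[OF t(1) inT(1)] W_le_2[OF t(1) inT(2)]
      W_le_2[OF t(1) inT(3)] W_le_2[OF t(1) inT(4)] t(4) dist by (auto simp: doubleton_eq_iff)
  qed
  have "S t1 t1 = 0" "S t2 t2 = 0" "S t3 t3 = 0" "S t4 t4 = 0"
    using z[of t1 t2] z[of t2 t1] z[of t3 t4] z[of t4 t3] inT s by (auto simp: insert_commute)
  then have d: "S t1 t1 = 0" "S t2 t1 = 1" "S t1 t2 = 1" "S t2 t2 = 0" "S t3 t3 = 0" "S t4 t3 = 1"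
    "S t3 t4 = 1" "S t4 t4 = 0" using s by auto
  have "3 * (\<Sum>z\<in>F. a t1 z * a z t3) + S t1 t4 = 9"
    using sq_TT3[OF inT(1,3)] d s(3) dist by (simp add: Tsum)
  then have "S t1 t4 = 0 \<or> S t1 t4 = 3" using W_bounds_3(4)[OF p3 inT(1,4)] by auto presburger+
  then have "W t1 t4 \<le> 0" using W_le_0 inT by auto
  moreover have "3 * (\<Sum>z\<in>F. a t1 z * a z t4) + S t1 t3 = 9"
    using sq_TT3[OF inT(1,4)] d s(4) dist by (simp add: Tsum)
  then have "S t1 t3 = 0 \<or> S t1 t3 = 3" using W_bounds_3(4)[OF p3 inT(1,3)] by auto presburger+
  then have "W t1 t3 \<le> 0" using W_le_0 inT by auto
  ultimately show False using W4[OF inT(1)] W_le_2[OF inT(1,2)] W_diag_3[OF p3 inT(1)] d by simp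
qed

text \<open>The zeros \<open>S t1 t3\<close> and \<open>S t2 t4\<close> remove one positive summand
  from rows 1 to 3 of \<open>W\<close>. The row sums are then reached only if the remaining summands
  are 2, and \<open>W_eq_2\<close> reads off the entries.\<close>

lemma quotient_01_rows:
  assumes s: "S t1 t1 + S t2 t1 = 3" "S t1 t2 + S t2 t2 = 3" "S t1 t3 + S t2 t3 = 1" "S t1 t4 + S t2 t4 = 1"
    "S t3 t3 + S t4 t3 = 2" "S t3 t4 + S t4 t4 = 2" "S t3 t1 + S t4 t1 = 2" "S t3 t2 + S t4 t2 = 2"
    and 13: "S t1 t3 = 0" and 14: "S t1 t4 = 1"
  shows "S t1 t1 = 2 \<and> S t1 t2 = 1 \<and> S t3 t1 = 1 \<and> S t3 t2 = 1 \<and> S t3 t3 = 0 \<and> S t3 t4 = 2"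
proof -
  have 23: "S t2 t3 = 1" and 24: "S t2 t4 = 0" using s 13 14 by auto
  have w: "W t1 t3 \<le> 0" "W t2 t4 \<le> 0" "W t3 t1 \<le> 0" by (rule W_le_0; use inT 13 24 in simp)+
  have 11: "S t1 t1 = 2" "W t1 t2 + W t1 t4 \<ge> 4"
  proof -
    have "S t1 t1 \<in> {0, 1, 2}" using S_diag_3[OF p3 inT(1)] .
    moreover have "S t1 t1 = 0 \<Longrightarrow> W t1 t2 \<le> 0" by (rule W_le_0) (use inT s in auto)
    ultimately show "S t1 t1 = 2" "W t1 t2 + W t1 t4 \<ge> 4"
      using W4[OF inT(1)] W_diag_3[OF p3 inT(1)] W_le_2[OF inT(1,2)] W_le_2[OF inT(1,4)] w by auto
  qed
  have 22: "W t2 t1 + W t2 t3 \<ge> 4"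
  proof -
    have "S t2 t2 \<in> {0, 1, 2}" using S_diag_3[OF p3 inT(2)] .
    moreover have "S t2 t2 = 0 \<Longrightarrow> W t2 t1 \<le> 0" by (rule W_le_0) (use inT s in auto)
    ultimately show "W t2 t1 + W t2 t3 \<ge> 4"
      using W4[OF inT(2)] W_diag_3[OF p3 inT(2)] W_le_2[OF inT(2,1)] W_le_2[OF inT(2,3)] w by auto
  qed
  have "W t1 t4 \<ge> 2" "W t1 t2 \<ge> 2" "W t2 t3 \<ge> 2"
    using 11 22 W_le_2[OF inT(1,2)] W_le_2[OF inT(1,4)] W_le_2[OF inT(2,1)] W_le_2[OF inT(2,3)] by auto
  then have e: "S t4 t1 = 1" "S t3 t2 = 1" "S t2 t1 = 1" "S t1 t2 = 1"
    using W_eq_2[OF inT(1,4)] W_eq_2[OF inT(1,2)] W_eq_2[OF inT(2,3)] 14 23 11 s by auto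
  have "S t3 t3 \<in> {0, 1, 2}" using S_diag_3[OF p3 inT(3)] .
  moreover have "S t3 t3 = 2 \<Longrightarrow> W t3 t4 \<le> 0" by (rule W_le_0) (use inT s in auto)
  ultimately have "S t3 t3 = 0" "W t3 t4 \<ge> 2"
    using W4[OF inT(3)] W_diag_3[OF p3 inT(3)] W_le_2[OF inT(3,2)] W_le_2[OF inT(3,4)] w by auto
  then show ?thesis using W_eq_2[OF inT(3,4)] e 11 s by auto
qed

text \<open>The hypotheses make \<open>S t2 t3\<close> and \<open>S t2 t4\<close> zero, so only t1
  and t2 can contribute to row t2 of \<open>W\<close>, which is too little.\<close>

lemma not_both_one:
  assumes s: "S t1 t2 + S t2 t2 = 3" "S t1 t3 + S t2 t3 = 1" "S t1 t4 + S t2 t4 = 1"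
    and "S t1 t3 = 1" "S t1 t4 = 1"
  shows False
proof -
  have "W t2 t3 \<le> 0" "W t2 t4 \<le> 0" by (rule W_le_0; use inT assms in simp)+
  moreover have "S t2 t2 \<in> {0, 1, 2}" using S_diag_3[OF p3 inT(2)] .
  moreover have "S t2 t2 = 0 \<Longrightarrow> W t2 t1 \<le> 0" by (rule W_le_0) (use inT s in auto)
  ultimately show False
    using W4[OF inT(2)] W_diag_3[OF p3 inT(2)] W_le_2[OF inT(2,1)] by auto
qed

end

text \<open>By \<open>P_F\<close> the adjacency matrix of F satisfies A^2 = 2I - A + J, the equation
  of the Petersen graph. The assumptions are invariant under the permutations of the orbits that
  keep the pairs {t1, t2} and {t3, t4}.\<close>

locale petersen = four_orbits +
  assumes cardF: "card F = 10"
    and symF: "x \<in> F \<Longrightarrow> y \<in> F \<Longrightarrow> a x y = a y x"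
    and b3: "x \<in> F \<Longrightarrow> b x = 3"
    and P_F: "x \<in> F \<Longrightarrow> y \<in> F \<Longrightarrow> P x y = 1 - a x y + (if x = y then 2 else 0)"
    and L_F: "x \<in> F \<Longrightarrow> y \<in> F \<Longrightarrow> L x y = 1"
    and classes: "x \<in> F \<Longrightarrow> a x t2 = a x t1 \<and> a x t3 = 1 - a x t1 \<and> a x t4 = 1 - a x t1"
begin

lemma petersen_swap34: "petersen V a r p t1 t2 t4 t3"
  using swap34 cardF symF b3 P_F L_F classes
  by (simp add: petersen_def petersen_axioms_def)

lemma petersen_swap_pairs: "petersen V a r p t3 t4 t1 t2"
  using swap_pairs cardF symF b3 P_F L_F classes
  by (simp add: petersen_def petersen_axioms_def)

lemma petersen_swap12: "petersen V a r p t2 t1 t3 t4"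
proof -
  have "four_orbits V a r p t2 t1 t3 t4" by unfold_locales (use T dist in auto)
  then show ?thesis using cardF symF b3 P_F L_F classes
    by (simp add: petersen_def petersen_axioms_def)
qed

text \<open>Otherwise all ten fixed vertices would send an arc to t3, whose in-degree is 9.\<close>

lemma both_classes: "\<exists>x\<in>F. a x t1 = 1"
proof (rule ccontr)
  assume "\<not> ?thesis"
  then have "a x t3 = 1" if "x \<in> F" for x using classes[OF that] a01[of x t1] that by auto
  then have "(\<Sum>x\<in>F. a x t3) = 10" using cardF by simp
  moreover have "0 \<le> (\<Sum>t\<in>T. S t t3)" by (intro sum_nonneg S_ge0)
  moreover have "(\<Sum>t\<in>T. \<Sum>z\<in>orb t. a z t3) = (\<Sum>t\<in>T. S t t3)"
    using S_col inT by (intro sum.cong) auto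
  ultimately show False using colsum[OF TV[OF inT(3)]] V_sum[of "\<lambda>z. a z t3"] by simp
qed

lemma column_sum: "(\<Sum>x\<in>F. a x t1) + (S t1 t1 + S t2 t1) + (S t3 t1 + S t4 t1) = 9"
  using colsum[OF TV[OF inT(1)]] V_sum[of "\<lambda>z. a z t1"] S_col[OF _ inT(1)] inT by (simp add: Tsum)

lemma class_sums: assumes x: "x \<in> F" "a x t1 = 1"
  shows "(\<Sum>z\<in>F. a x z * a z t1) = 3 - (S t1 t1 + S t2 t1)"
    and "S t1 t2 + S t2 t2 = S t1 t1 + S t2 t1"
    and "S t1 t3 + S t2 t3 = 4 - (S t1 t1 + S t2 t1)"
    and "S t1 t4 + S t2 t4 = 4 - (S t1 t1 + S t2 t1)"
proof -
  note c = classes[OF x(1)] x(2)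
  show 1: "(\<Sum>z\<in>F. a x z * a z t1) = 3 - (S t1 t1 + S t2 t1)"
    using sq_FT[OF x(1) inT(1)] c by (simp add: Tsum)
  have "(\<Sum>z\<in>F. a x z * a z t2) = (\<Sum>z\<in>F. a x z * a z t1)"
    using classes by (intro sum.cong) auto
  then show "S t1 t2 + S t2 t2 = S t1 t1 + S t2 t1"
    using sq_FT[OF x(1) inT(2)] c 1 by (simp add: Tsum)
  have 3: "(\<Sum>z\<in>F. a x z * (1 - a z t1)) = 3 - (\<Sum>z\<in>F. a x z * a z t1)"
    using b3[OF x(1)] unfolding b_def by (simp add: right_diff_distrib sum_subtractf)
  have "(\<Sum>z\<in>F. a x z * a z t3) = (\<Sum>z\<in>F. a x z * (1 - a z t1))"
    "(\<Sum>z\<in>F. a x z * a z t4) = (\<Sum>z\<in>F. a x z * (1 - a z t1))"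
    using classes by (auto intro!: sum.cong)
  then show "S t1 t3 + S t2 t3 = 4 - (S t1 t1 + S t2 t1)" "S t1 t4 + S t2 t4 = 4 - (S t1 t1 + S t2 t1)"
    using sq_FT[OF x(1) inT(3)] sq_FT[OF x(1) inT(4)] c 1 3 by (simp_all add: Tsum)
qed

lemma incidence_T: assumes "x \<in> F" shows "a t1 x + a t2 x = 1"
proof -
  obtain u where u: "u \<in> F" "a u t1 = 1" using both_classes by auto
  then show ?thesis using L_F[OF u(1) assms] classes[OF u(1)] by (simp add: L_def Tsum)
qed

text \<open>Let f1 and f3 be the indicators on F of the out-neighbours of t1 and t3. The equations
  give f1 A = 2 - 2 f1 + f3 and f3 A = 1 + f3, so both have 5 elements. Evaluating f1 A f3 from
  either side, A being symmetric on F, yields 15 - 2n = 5 + n for the size n of the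
  intersection.\<close>

lemma quotient_not_realised:
  assumes "S t1 t1 = 2" "S t1 t2 = 1" "S t1 t3 = 0" "S t1 t4 = 1"
    "S t3 t1 = 1" "S t3 t2 = 1" "S t3 t3 = 0" "S t3 t4 = 2"
  shows False
proof -
  interpret sw: petersen V a r p t3 t4 t1 t2 by (rule petersen_swap_pairs)
  have M1: "(\<Sum>z\<in>F. a t1 z * a z x) = 2 - 2 * a t1 x + a t3 x" if "x \<in> F" for x
    using sq_TF[OF that inT(1)] incidence_T[OF that] sw.incidence_T[OF that] assms by (simp add: Tsum)
  have M3: "(\<Sum>z\<in>F. a t3 z * a z x) = 1 + a t3 x" if "x \<in> F" for x
    using sq_TF[OF that inT(3)] incidence_T[OF that] sw.incidence_T[OF that] assms by (simp add: Tsum)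
  have row: "(\<Sum>x\<in>F. \<Sum>z\<in>F. g z * a z x) = 3 * (\<Sum>z\<in>F. g z)" for g
  proof -
    have "(\<Sum>x\<in>F. \<Sum>z\<in>F. g z * a z x) = (\<Sum>z\<in>F. g z * b z)"
      unfolding b_def by (subst sum.swap) (simp add: sum_distrib_left)
    also have "\<dots> = (\<Sum>z\<in>F. 3 * g z)" using b3 by (intro sum.cong) auto
    finally show ?thesis by (simp add: sum_distrib_left)
  qed
  let ?n1 = "\<Sum>z\<in>F. a t1 z" and ?n3 = "\<Sum>z\<in>F. a t3 z" and ?n = "\<Sum>z\<in>F. a t1 z * a t3 z"
  have "(\<Sum>x\<in>F. \<Sum>z\<in>F. a t3 z * a z x) = (\<Sum>x\<in>F. 1 + a t3 x)" using M3 by (intro sum.cong) auto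
  then have 5: "?n3 = 5" using row[of "a t3"] cardF by (simp add: sum.distrib)
  have "(\<Sum>x\<in>F. \<Sum>z\<in>F. a t1 z * a z x) = (\<Sum>x\<in>F. 2 - 2 * a t1 x + a t3 x)"
    using M1 by (intro sum.cong) auto
  then have 6: "?n1 = 5" using row[of "a t1"] cardF 5
    by (simp add: sum.distrib sum_subtractf sum_distrib_left[symmetric])
  have sqa: "a u v * a u v = a u v" for u v using a01[of u v] by auto
  have A: "(\<Sum>x\<in>F. (\<Sum>z\<in>F. a t1 z * a z x) * a t3 x) = (\<Sum>x\<in>F. 2 * a t3 x - 2 * (a t1 x * a t3 x) + a t3 x)"
  proof (rule sum.cong[OF refl])
    fix x assume "x \<in> F"
    then have "(\<Sum>z\<in>F. a t1 z * a z x) * a t3 x = (2 - 2 * a t1 x + a t3 x) * a t3 x" using M1 by simp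
    then show "(\<Sum>z\<in>F. a t1 z * a z x) * a t3 x = 2 * a t3 x - 2 * (a t1 x * a t3 x) + a t3 x"
      using sqa[of t3 x] by (simp only: left_diff_distrib distrib_right mult.assoc)
  qed
  have "(\<Sum>x\<in>F. (\<Sum>z\<in>F. a t1 z * a z x) * a t3 x) = (\<Sum>z\<in>F. (\<Sum>x\<in>F. a t3 x * a x z) * a t1 z)"
    unfolding sum_distrib_right by (subst sum.swap) (auto intro!: sum.cong simp: symF algebra_simps)
  also have "\<dots> = (\<Sum>z\<in>F. a t1 z + a t1 z * a t3 z)"
    using M3 by (intro sum.cong) (auto simp: algebra_simps)
  finally have "3 * ?n = 10" using A 5 6
    by (simp add: sum.distrib sum_subtractf sum_distrib_left[symmetric])
  then show False by presburger
qed

text \<open>If a vertex of the class of \<open>t1\<close> has \<open>y\<close> neighbours in its class, and a vertex of the other class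
  has \<open>w\<close> in its own, the identity comes from counting paths of length two that stay within the class
  of \<open>t1\<close> at both ends.\<close>

lemma class_degree_equation:
  assumes y: "y = 3 - (S t1 t1 + S t2 t1)" and w: "w = 3 - (S t3 t3 + S t4 t3)"
  shows "(y - 2) * (y + w - 1) = 0" "0 \<le> y"
proof -
  interpret sw: petersen V a r p t3 t4 t1 t2 by (rule petersen_swap_pairs)
  obtain x where x: "x \<in> F" "a x t1 = 1" using both_classes by auto
  obtain x' where x': "x' \<in> F" "a x' t3 = 1" using sw.both_classes by auto
  have n: "(\<Sum>x\<in>F. a x t1) = 5 + y - w" using column_sum class_sums[OF x] sw.class_sums[OF x'] y w by simp
  have yx: "(\<Sum>z\<in>F. a u z * a z t1) = y" if "u \<in> F" "a u t1 = 1" for u using class_sums(1)[OF that] y by simp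
  have "0 \<le> (\<Sum>z\<in>F. a x z * a z t1)" by (intro sum_nonneg mult_nonneg_nonneg a_ge0)
  then show "0 \<le> y" using yx[OF x] by simp
  have wx: "(\<Sum>z\<in>F. a u z * a z t1) = 3 - w" if u: "u \<in> F" "a u t1 = 0" for u
  proof -
    have "a u t3 = 1" using classes[OF u(1)] u by simp
    then have "(\<Sum>z\<in>F. a u z * a z t3) = w" using sw.class_sums(1)[OF u(1)] w by simp
    moreover have "(\<Sum>z\<in>F. a u z * a z t3) = (\<Sum>z\<in>F. a u z * (1 - a z t1))"
      using classes by (intro sum.cong) auto
    ultimately show ?thesis using b3[OF u(1)] unfolding b_def by (simp add: right_diff_distrib sum_subtractf)
  qed
  have g: "(\<Sum>v\<in>F. a u v * a v t1) = y * a u t1 + (3 - w) * (1 - a u t1)" if "u \<in> F" for u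
    using yx[OF that] wx[OF that] a01[of u t1] by auto
  have "(\<Sum>v\<in>F. P x v * a v t1) = (\<Sum>u\<in>F. a x u * (\<Sum>v\<in>F. a u v * a v t1))"
    unfolding P_def sum_distrib_right sum_distrib_left by (subst sum.swap) (simp add: mult.assoc)
  also have "\<dots> = (\<Sum>u\<in>F. y * (a x u * a u t1) + (3 - w) * (a x u - a x u * a u t1))"
  proof (rule sum.cong[OF refl])
    fix u assume "u \<in> F"
    then show "a x u * (\<Sum>v\<in>F. a u v * a v t1) = y * (a x u * a u t1) + (3 - w) * (a x u - a x u * a u t1)"
      unfolding g[OF \<open>u \<in> F\<close>] by (simp add: algebra_simps)
  qed
  also have "\<dots> = y * y + (3 - w) * (3 - y)"
    using yx[OF x] b3[OF x(1)] unfolding b_def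
    by (simp add: sum.distrib sum_subtractf sum_distrib_left[symmetric])
  finally have 1: "(\<Sum>v\<in>F. P x v * a v t1) = y * y + (3 - w) * (3 - y)" .
  have "(\<Sum>v\<in>F. P x v * a v t1) = (\<Sum>v\<in>F. a v t1 - a x v * a v t1 + (if x = v then 2 * a v t1 else 0))"
    using P_F[OF x(1)] by (intro sum.cong refl) (simp only: distrib_right left_diff_distrib, simp)
  also have "\<dots> = 5 + y - w - y + 2" using n yx[OF x] x
    by (simp add: sum.distrib sum_subtractf)
  finally show "(y - 2) * (y + w - 1) = 0" using 1 by (simp add: algebra_simps)
qed

text \<open>Of the four choices of (\<open>S t1 t3\<close>, \<open>S t1 t4\<close>), exchanging t1
  with t2 identifies (0, 0) with (1, 1), and exchanging t3 with t4 identifies (1, 0) with (0,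
  1).\<close>

lemma class_degrees_not_01: assumes "S t1 t1 + S t2 t1 = 3" "S t3 t3 + S t4 t3 = 2" shows False
proof -
  interpret sw: petersen V a r p t3 t4 t1 t2 by (rule petersen_swap_pairs)
  interpret sw34: petersen V a r p t1 t2 t4 t3 by (rule petersen_swap34)
  interpret sw12: petersen V a r p t2 t1 t3 t4 by (rule petersen_swap12)
  obtain x where x: "x \<in> F" "a x t1 = 1" using both_classes by auto
  obtain x' where x': "x' \<in> F" "a x' t3 = 1" using sw.both_classes by auto
  have s: "S t1 t1 + S t2 t1 = 3" "S t1 t2 + S t2 t2 = 3" "S t1 t3 + S t2 t3 = 1" "S t1 t4 + S t2 t4 = 1"
    "S t3 t3 + S t4 t3 = 2" "S t3 t4 + S t4 t4 = 2" "S t3 t1 + S t4 t1 = 2" "S t3 t2 + S t4 t2 = 2"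
    using class_sums[OF x] sw.class_sums[OF x'] assms by auto
  have "S t1 t3 = 0 \<or> S t1 t3 = 1" "S t1 t4 = 0 \<or> S t1 t4 = 1"
    using s S_ge0[of t1 t3] S_ge0[of t2 t3] S_ge0[of t1 t4] S_ge0[of t2 t4] by auto
  moreover have "\<not> (S t1 t3 = 1 \<and> S t1 t4 = 1)" using not_both_one s by auto
  moreover have "\<not> (S t1 t3 = 0 \<and> S t1 t4 = 0)" using sw12.not_both_one s by auto
  ultimately consider "S t1 t3 = 0" "S t1 t4 = 1" | "S t1 t3 = 1" "S t1 t4 = 0" by auto
  then show False
  proof cases
    case 1
    then show ?thesis using quotient_01_rows[OF s] quotient_not_realised by simp
  next
    case 2
    then show ?thesis using sw34.quotient_01_rows sw34.quotient_not_realised s by (simp add: add.commute)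
  qed
qed

lemma contradiction: False
proof -
  interpret sw: petersen V a r p t3 t4 t1 t2 by (rule petersen_swap_pairs)
  define y w where y: "y = 3 - (S t1 t1 + S t2 t1)" and w: "w = 3 - (S t3 t3 + S t4 t3)"
  have "(y - 2) * (y + w - 1) = 0" "0 \<le> y" "(w - 2) * (w + y - 1) = 0" "0 \<le> w"
    using class_degree_equation[OF y w] sw.class_degree_equation[OF w y] by auto
  then have c: "(y = 2 \<and> w = 2) \<or> (y = 0 \<and> w = 1) \<or> (y = 1 \<and> w = 0)" by auto
  obtain x where x: "x \<in> F" "a x t1 = 1" using both_classes by auto
  obtain x' where x': "x' \<in> F" "a x' t3 = 1" using sw.both_classes by auto
  show False using c
  proof (elim disjE conjE)
    assume "y = 2" "w = 2"
    then show False using quotient_22_impossible class_sums[OF x] sw.class_sums[OF x'] y w by simp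
  next
    assume "y = 0" "w = 1"
    then show False using class_degrees_not_01 y w by simp
  next
    assume "y = 1" "w = 0"
    then show False using sw.class_degrees_not_01 y w by simp
  qed
qed

end

section \<open>Excluding 10 fixed points\<close>

context cyc_aut3
begin

lemma F10_out_classes:
  assumes f: "card F = 10" and b3: "\<And>x. x \<in> F \<Longrightarrow> b x = 3"
    and sym: "\<And>x y. x \<in> F \<Longrightarrow> y \<in> F \<Longrightarrow> a x y = a y x"
    and L: "\<And>x y. x \<in> F \<Longrightarrow> y \<in> F \<Longrightarrow> L x y = 1"
    and U: "U \<subseteq> T" "card U = 2" "\<And>x. x \<in> F \<Longrightarrow> {t \<in> T. a x t = 1} = U \<or> {t \<in> T. a x t = 1} = T - U"
  shows False
proof -
  have cT: "card T = 4" using card_eq p3 f by simp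
  obtain t1 t2 where 1: "U = {t1, t2}" "t1 \<noteq> t2" using U(2) by (auto simp: card_2_iff)
  have "card (T - U) = 2" using cT U finite_subset[OF U(1)] by (simp add: card_Diff_subset)
  then obtain t3 t4 where 2: "T - U = {t3, t4}" "t3 \<noteq> t4" by (auto simp: card_2_iff)
  have T: "T = {t1, t2, t3, t4}" "distinct [t1, t2, t3, t4]" using 1 2 U(1) by auto
  have "petersen V a r p t1 t2 t3 t4"
  proof unfold_locales
    show "T = {t1, t2, t3, t4}" "distinct [t1, t2, t3, t4]" by (fact T)+
    fix x assume x: "x \<in> F"
    have cl: "(\<forall>t\<in>T. a x t = 1 \<longleftrightarrow> t \<in> U) \<or> (\<forall>t\<in>T. a x t = 1 \<longleftrightarrow> t \<in> T - U)" using U(3)[OF x] by blast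
    then show "a x t2 = a x t1 \<and> a x t3 = 1 - a x t1 \<and> a x t4 = 1 - a x t1"
      using a01[of x t1] a01[of x t2] a01[of x t3] a01[of x t4] T unfolding 1 by (elim disjE) auto
    fix y assume y: "y \<in> F"
    show "P x y = 1 - a x y + (if x = y then 2 else 0)"
      using P_L[OF x y] L[OF x y] by auto
  qed (use f b3 sym L in auto)
  then show False by (rule petersen.contradiction)
qed

text \<open>For fixed x and y, the pair of orbits entered from x and the pair with arcs to y share
  exactly one of the four orbits, by L = 1. This forces the out-pairs or the in-pairs to take at
  most two complementary values; in the second case the reversed digraph is used.\<close>

lemma card_F_not_10: "card F \<noteq> 10"
proof
  assume f: "card F = 10"
  have b3: "b x = 3" if "x \<in> F" for x using F10_regular[OF f] F10_not_6_regular[OF f] that by auto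
  have cT: "card T = 4" using card_eq p3 f by simp
  have Pxx: "P x x = 3" if x: "x \<in> F" for x
    using b3_sum[OF x b3[OF x]] sum_const[of 3 x] b3 x f by auto
  have sym: "a x y = a y x" if "x \<in> F" "y \<in> F" for x y
    using F_sym[of x y] F_sym[of y x] Pxx b3 that by fastforce
  have L: "L x y = 1" if "x \<in> F" "y \<in> F" for x y
  proof (cases "x = y")
    case True
    then show ?thesis using P_L[OF that] Pxx noloop[of x] FV that by auto
  next
    case False
    then show ?thesis using P_L[OF that] P_if_b3[OF that(1) b3[OF that(1)] that(2)] by auto
  qed
  define O' I' where "O' x = {t \<in> T. a x t = 1}" and "I' x = {t \<in> T. a t x = 1}" for x
  have cO: "card (O' x) = 2" if x: "x \<in> F" for x
    using b_row[OF x] b3[OF x] sum_01_eq_card[OF finT, of "a x"] a01 unfolding O'_def by simp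
  have cI: "card (I' x) = 2" if x: "x \<in> F" for x
  proof -
    have "(\<Sum>y\<in>F. a y x) = b x" unfolding b_def using sym x by (intro sum.cong) auto
    then show ?thesis
      using b_col[OF x] b3[OF x] sum_01_eq_card[OF finT, of "\<lambda>t. a t x"] a01 unfolding I'_def by simp
  qed
  have cOI: "card (O' x \<inter> I' y) = 1" if x: "x \<in> F" "y \<in> F" for x y
  proof -
    have "a x t * a t y = 1 \<longleftrightarrow> a x t = 1 \<and> a t y = 1" "a x t * a t y = 0 \<or> a x t * a t y = 1" for t
      using a01[of x t] a01[of t y] by auto
    then have "L x y = int (card {t \<in> T. a x t = 1 \<and> a t y = 1})"
      using sum_01_eq_card[OF finT, of "\<lambda>t. a x t * a t y"] unfolding L_def by simp
    moreover have "O' x \<inter> I' y = {t \<in> T. a x t = 1 \<and> a t y = 1}" unfolding O'_def I'_def by auto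
    ultimately show ?thesis using L[OF x] by simp
  qed
  have OT: "O' x \<subseteq> T" "I' x \<subseteq> T" for x unfolding O'_def I'_def by auto
  obtain x0 where x0: "x0 \<in> F" using f by fastforce
  show False
  proof (cases "\<forall>x\<in>F. O' x = O' x0 \<or> O' x = T - O' x0")
    case True
    then show False using F10_out_classes[OF f b3 sym L OT(1) cO[OF x0]] unfolding O'_def by auto
  next
    case False
    then obtain x1 where x1: "x1 \<in> F" "O' x1 \<noteq> O' x0" "O' x1 \<noteq> T - O' x0" by auto
    obtain u v where uv: "O' x0 = {u, v}" "u \<noteq> v" using cO[OF x0] by (auto simp: card_2_iff)
    have "card (T - O' x0) = 2" using cT cO[OF x0] OT finite_subset[OF OT(1)] by (simp add: card_Diff_subset)
    then obtain w z where wz: "T - O' x0 = {w, z}" "w \<noteq> z" by (auto simp: card_2_iff)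
    have T4: "T = {u, v, w, z}" "distinct [u, v, w, z]" using uv wz OT(1)[of x0] by auto
    obtain c d where cd: "O' x1 = {c, d}" "c \<noteq> d" using cO[OF x1(1)] by (auto simp: card_2_iff)
    \<comment> \<open>Two out-pairs that are neither equal nor complementary share one orbit; the
      pairs that meet both in exactly one orbit are then just two, complementary to each
      other.\<close>
    have I2: "I' y = I' x0 \<or> I' y = T - I' x0" if y: "y \<in> F" for y
    proof -
      obtain e g where eg: "I' y = {e, g}" "e \<noteq> g" using cI[OF y] by (auto simp: card_2_iff)
      obtain e0 g0 where eg0: "I' x0 = {e0, g0}" "e0 \<noteq> g0" using cI[OF x0] by (auto simp: card_2_iff)
      have mem: "{c, d, e, g, e0, g0} \<subseteq> {u, v, w, z}" using OT T4 cd eg eg0 by (metis empty_subsetI insert_subset)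
      have i: "card ({u, v} \<inter> {e, g}) = 1" "card ({c, d} \<inter> {e, g}) = 1"
        "card ({u, v} \<inter> {e0, g0}) = 1" "card ({c, d} \<inter> {e0, g0}) = 1"
        using cOI x0 x1(1) y uv cd eg eg0 by metis+
      have ne: "{c, d} \<noteq> {u, v}" "{c, d} \<noteq> {w, z}" using x1 uv cd wz by auto
      show ?thesis unfolding eg eg0 T4(1) using i ne mem T4(2) cd(2) eg(2) eg0(2)
        by (auto simp: insert_Diff_if Int_insert_left insert_commute doubleton_eq_iff split: if_splits)
    qed
    interpret dual: cyc_aut3 V "\<lambda>x y. a y x" r p by (rule dual3)
    have "(\<Sum>y\<in>F. a y x) = b x" if "x \<in> F" for x unfolding b_def using sym that by (intro sum.cong) auto
    then have "dual.b x = 3" if "x \<in> F" for x using b3 that unfolding dual.b_def by simp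
    moreover have "dual.L x y = L y x" for x y unfolding dual.L_def L_def by (simp add: mult.commute)
    ultimately show False using dual.F10_out_classes[OF f _ _ _ OT(2)[of x0] cI[OF x0]] I2 sym L
      unfolding I'_def by auto
  qed
qed

end


section \<open>Order 3 with 13 fixed points\<close>

text \<open>The conditions make both \<open>Z\<close> and \<open>Z'\<close> induced hexagons, which share a path \<open>x0 x1 x2\<close>. Writing
  \<open>x5 x0 x1 x2 x3\<close> for a path in \<open>Z\<close> and \<open>q u0 x0 x1 x2 u2 q\<close> for \<open>Z'\<close>, all in-neighbours of \<open>u0\<close>, \<open>u2\<close>
  and \<open>q\<close> get determined, and a further vertex of \<open>Q\<close> is left with at most two out-neighbours in \<open>Q\<close>.\<close>

lemma hexagon_contradiction:
  fixes E :: "'a \<Rightarrow> 'a \<Rightarrow> bool"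
  assumes fin: "finite Z" "finite Q" "finite Z'"
    and card: "card Z = 6" "card Q = 6" "card (Z \<inter> Z') = 3" "card (Z' \<inter> Q) = 3" "Z' \<subseteq> Z \<union> Q" "Z \<inter> Q = {}"
    and irrefl: "\<And>x. \<not> E x x"
    and Z_out: "\<And>x. x \<in> Z \<Longrightarrow> {z. E x z} \<subseteq> Z \<union> Q" "\<And>x. x \<in> Z \<Longrightarrow> card {z. E x z} = 3"
      "\<And>x. x \<in> Z \<Longrightarrow> card ({z. E x z} \<inter> Z) = 2" "\<And>x z. x \<in> Z \<Longrightarrow> E x z \<Longrightarrow> E z x"
    and Z'_in: "\<And>y. y \<in> Z' \<Longrightarrow> card {z. E z y} = 3" "\<And>y. y \<in> Z' \<Longrightarrow> card ({z. E z y} \<inter> Z') = 2"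
      "\<And>y z. y \<in> Z' \<Longrightarrow> E z y \<Longrightarrow> E y z"
    and no_path: "\<And>x y m. x \<in> Z \<Longrightarrow> E x y \<Longrightarrow> E x m \<Longrightarrow> \<not> E m y"
    and one_path: "\<And>x y. x \<in> Z \<Longrightarrow> y \<in> Z' \<Longrightarrow> x \<noteq> y \<Longrightarrow> \<not> E x y \<Longrightarrow> \<exists>!m. E x m \<and> E m y"
    and Q_out: "\<And>x. x \<in> Q \<Longrightarrow> card ({z. E x z} \<inter> Q) = 3"
  shows False
proof -
  have finN: "finite {z. E x z}" if "x \<in> Z" for x using Z_out(2)[OF that] card.infinite by fastforce
  have finI: "finite {z. E z x}" if "x \<in> Z'" for x using Z'_in(1)[OF that] card.infinite by fastforce
  have sym: "E x z \<longleftrightarrow> E z x" if "x \<in> Z" "x \<in> Z'" for x z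
    using Z_out(4)[OF that(1)] Z'_in(3)[OF that(2)] by blast
  have N_eq: "{z. E x z} \<inter> Z = {u, v}" if "x \<in> Z" "E x u" "E x v" "u \<in> Z" "v \<in> Z" "u \<noteq> v" for x u v
    using card_subset_eq[of "{z. E x z} \<inter> Z" "{u, v}"] Z_out(3)[OF that(1)] finN[OF that(1)] that by auto
  have I_eq: "{z. E z x} \<inter> Z' = {u, v}" if "x \<in> Z'" "E u x" "E v x" "u \<in> Z'" "v \<in> Z'" "u \<noteq> v" for x u v
    using card_subset_eq[of "{z. E z x} \<inter> Z'" "{u, v}"] Z'_in(2)[OF that(1)] finI[OF that(1)] that by auto
  \<comment> \<open>Two neighbours in Z and two in Z' cannot all differ when there are three in
    total. Hence no common vertex is isolated from the other two, and the three form a path.\<close>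
  have nb: "\<exists>z. E x z \<and> z \<in> Z \<inter> Z'" if x: "x \<in> Z" "x \<in> Z'" for x
  proof (rule ccontr)
    assume "\<not> ?thesis"
    then have "({z. E x z} \<inter> Z) \<inter> ({z. E x z} \<inter> Z') = {}" by auto
    moreover have "{z. E x z} \<inter> Z' = {z. E z x} \<inter> Z'" using sym[OF x] by auto
    ultimately have "card (({z. E x z} \<inter> Z) \<union> ({z. E x z} \<inter> Z')) = 4"
      using Z_out(3)[OF x(1)] Z'_in(2)[OF x(2)] finN[OF x(1)] by (subst card_Un_disjoint) auto
    moreover have "card (({z. E x z} \<inter> Z) \<union> ({z. E x z} \<inter> Z')) \<le> card {z. E x z}"
      by (rule card_mono) (use finN[OF x(1)] in auto)
    ultimately show False using Z_out(2)[OF x(1)] by simp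
  qed
  obtain x0 x1 x2 where V: "Z \<inter> Z' = {x0, x1, x2}" "x0 \<noteq> x1" "x2 \<noteq> x1" "x0 \<noteq> x2" "E x1 x0" "E x1 x2"
  proof -
    have "Z \<inter> Z' \<noteq> {}" using card(3) by auto
    then obtain c where c: "c \<in> Z" "c \<in> Z'" by auto
    obtain d where d: "E c d" "d \<in> Z" "d \<in> Z'" using nb[OF c] by auto
    have cd: "c \<noteq> d" using d irrefl by auto
    have "card (Z \<inter> Z' - {c, d}) = 1" using card(3) c d cd by (subst card_Diff_subset) auto
    then obtain e where e: "Z \<inter> Z' - {c, d} = {e}" by (rule card_1_singletonE)
    then have V: "Z \<inter> Z' = {c, d, e}" "e \<noteq> c" "e \<noteq> d" using c d by auto
    then have "e \<in> Z" "e \<in> Z'" by auto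
    then obtain g where g: "E e g" "g \<in> Z \<inter> Z'" using nb by blast
    then consider "E e c" | "E e d" using V irrefl by auto
    then show thesis
    proof cases
      case 1
      then have "E c e" using sym[OF c] by blast
      then show thesis by (intro that[of d c e]) (use V cd d in auto)
    next
      case 2
      then have "E d e" "E d c" using sym[OF d(2,3)] d(1) by blast+
      then show thesis by (intro that[of c d e]) (use V cd in auto)
    qed
  qed
  have inV: "x0 \<in> Z" "x0 \<in> Z'" "x1 \<in> Z" "x1 \<in> Z'" "x2 \<in> Z" "x2 \<in> Z'" using V(1) by auto
  have n02: "\<not> E x0 x2" using no_path[OF inV(3) V(6) V(5)] .
  have n20: "\<not> E x2 x0" using n02 sym inV by blast
  have e01: "E x0 x1" "E x2 x1" using V sym inV by blast+
  obtain u1 where u1: "{z. E x1 z} = {x0, x2, u1}" "u1 \<in> Q" "u1 \<notin> Z'"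
  proof -
    have N: "{z. E x1 z} \<inter> Z = {x0, x2}" by (rule N_eq) (use inV V in auto)
    have I: "{z. E z x1} \<inter> Z' = {x0, x2}" by (rule I_eq) (use inV V e01 in auto)
    have "card ({z. E x1 z} - {x0, x2}) = 1"
      using Z_out(2)[OF inV(3)] V by (subst card_Diff_subset) auto
    then obtain u where u: "{z. E x1 z} - {x0, x2} = {u}" by (rule card_1_singletonE)
    then have 1: "{z. E x1 z} = {x0, x2, u}" "u \<noteq> x0" "u \<noteq> x2" using V by auto
    moreover from 1 have "E x1 u" "E u x1" using sym[OF inV(3,4), of u] by auto
    ultimately show thesis using that[of u] Z_out(1)[OF inV(3)] N I by blast
  qed
  have ends: "\<exists>s u. {z. E x z} = {x1, s, u} \<and> s \<noteq> x1 \<and> s \<in> Z \<and> s \<notin> Z' \<and> u \<in> Q \<and> u \<in> Z'"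
    if x: "x \<in> Z" "x \<in> Z'" "E x x1" "\<forall>z. E x z \<longrightarrow> z \<in> Z \<longrightarrow> z \<in> Z' \<longrightarrow> z = x1" for x
  proof -
    obtain s where s: "E x s" "s \<in> Z" "s \<noteq> x1"
    proof -
      have "\<not> {z. E x z} \<inter> Z \<subseteq> {x1}"
        using card_mono[of "{x1}" "{z. E x z} \<inter> Z"] Z_out(3)[OF x(1)] by auto
      then show thesis using that by auto
    qed
    obtain u where u: "E u x" "u \<in> Z'" "u \<noteq> x1"
    proof -
      have "\<not> {z. E z x} \<inter> Z' \<subseteq> {x1}"
        using card_mono[of "{x1}" "{z. E z x} \<inter> Z'"] Z'_in(2)[OF x(2)] by auto
      then show thesis using that by auto
    qed
    have Eu: "E x u" using u sym[OF x(1,2)] by auto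
    have "s \<notin> Z'" "u \<notin> Z" using x(4) s u Eu by auto
    then have "s \<noteq> u" using s by auto
    then have "{x1, s, u} = {z. E x z}"
      by (intro card_subset_eq) (use finN[OF x(1)] Z_out(2)[OF x(1)] s u Eu x in auto)
    then show ?thesis using s u \<open>s \<notin> Z'\<close> \<open>u \<notin> Z\<close> Eu Z_out(1)[OF x(1)] by blast
  qed
  have end0: "z = x1" if "E x0 z" "z \<in> Z" "z \<in> Z'" for z
  proof -
    have "z \<in> {x0, x1, x2}" unfolding V(1)[symmetric] using that by simp
    then show ?thesis using that(1) n02 irrefl by auto
  qed
  have "\<exists>s u. {z. E x0 z} = {x1, s, u} \<and> s \<noteq> x1 \<and> s \<in> Z \<and> s \<notin> Z' \<and> u \<in> Q \<and> u \<in> Z'"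
    by (rule ends[OF inV(1,2) e01(1)]) (use end0 in blast)
  then obtain x5 u0 where x0: "{z. E x0 z} = {x1, x5, u0}" "x5 \<noteq> x1" "x5 \<in> Z" "x5 \<notin> Z'" "u0 \<in> Q" "u0 \<in> Z'"
    by (elim exE conjE) (rule that)
  have end2: "z = x1" if "E x2 z" "z \<in> Z" "z \<in> Z'" for z
  proof -
    have "z \<in> {x0, x1, x2}" unfolding V(1)[symmetric] using that by simp
    then show ?thesis using that(1) n20 irrefl by auto
  qed
  have "\<exists>s u. {z. E x2 z} = {x1, s, u} \<and> s \<noteq> x1 \<and> s \<in> Z \<and> s \<notin> Z' \<and> u \<in> Q \<and> u \<in> Z'"
    by (rule ends[OF inV(5,6) e01(2)]) (use end2 in blast)
  then obtain x3 u2 where x2: "{z. E x2 z} = {x1, x3, u2}" "x3 \<noteq> x1" "x3 \<in> Z" "x3 \<notin> Z'" "u2 \<in> Q" "u2 \<in> Z'"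
    by (elim exE conjE) (rule that)
  have O: "E x0 z \<longleftrightarrow> z \<in> {x1, x5, u0}" "E x1 z \<longleftrightarrow> z \<in> {x0, x2, u1}" "E x2 z \<longleftrightarrow> z \<in> {x1, x3, u2}" for z
    unfolding x0(1)[symmetric] x2(1)[symmetric] u1(1)[symmetric] by simp_all
  have I: "E z x0 \<longleftrightarrow> z \<in> {x1, x5, u0}" "E z x1 \<longleftrightarrow> z \<in> {x0, x2, u1}" "E z x2 \<longleftrightarrow> z \<in> {x1, x3, u2}" for z
    using sym[OF inV(1,2)] sym[OF inV(3,4)] sym[OF inV(5,6)] O by blast+
  have nQ: "x0 \<notin> Q" "x1 \<notin> Q" "x2 \<notin> Q" "x3 \<notin> Q" "x5 \<notin> Q"
    using card(6) inV(1,3,5) x0(3) x2(3) by (simp_all add: disjoint_iff)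
  have uniq: "m = x1" if "E x0 m" "E m x2" for m
    using one_path[OF inV(1) inV(6) V(4) n02] that e01(1) V(6) by blast
  have x35: "x3 \<noteq> x5"
  proof
    assume "x3 = x5"
    then have "x5 = x1" by (intro uniq) (simp_all add: O I)
    then show False using x0(2) by simp
  qed
  have u02: "u0 \<noteq> u2"
  proof
    assume "u0 = u2"
    then have "u0 = x1" by (intro uniq) (simp_all add: O I)
    then show False using x0(5) nQ by simp
  qed
  have ne: "u1 \<noteq> u0" "u1 \<noteq> u2" using u1 x0 x2 by auto
  have "card (Z' \<inter> Q - {u0, u2}) = 1" using card(4) x0 x2 u02 by (subst card_Diff_subset) auto
  then obtain q where "Z' \<inter> Q - {u0, u2} = {q}" by (rule card_1_singletonE)
  then have q: "q \<in> Z'" "q \<in> Q" "q \<noteq> u0" "q \<noteq> u2" and W: "Z' \<inter> Q = {u0, u2, q}" using x0 x2 by auto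
  have Z'_eq: "Z' = {x0, x1, x2, u0, u2, q}"
  proof -
    have "Z' = (Z \<inter> Z') \<union> (Z' \<inter> Q)" using card(5) by blast
    then show ?thesis unfolding V(1) W by (simp add: insert_commute)
  qed
  have nq: "\<not> E x0 q" "\<not> E x1 q" "\<not> E x2 q"
    unfolding O using nQ q u1 by auto
  have "{z. E z q} \<inter> Z' = {u0, u2}"
  proof (rule card_subset_eq)
    show "{z. E z q} \<inter> Z' \<subseteq> {u0, u2}" unfolding Z'_eq using nq irrefl by auto
  qed (use Z'_in(2)[OF q(1)] u02 in auto)
  then have uq: "E u0 q" "E u2 q" by auto
  then have qu: "E q u0" "E q u2" using Z'_in(3)[OF q(1)] by auto
  \<comment> \<open>The middle vertex is x0, x2 or u1, and the first two have no arc to q.\<close>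
  obtain m where "E x1 m" "E m q" using one_path[OF inV(3) q(1) _ nq(2)] nQ q by auto
  then have u1q: "E u1 q" unfolding O using nq O by auto
  have In_q: "{z. E z q} = {u0, u1, u2}"
    by (rule card_subset_eq[symmetric])
      (use uq u1q ne u02 Z'_in(1)[OF q(1)] finI[OF q(1)] in auto)
  \<comment> \<open>Such an arc would close a pentagon in Z that uses up both Z-neighbours of each
    of its vertices and leaves the sixth vertex of Z with none.\<close>
  have no53: "\<not> E x3 x5"
  proof
    assume e: "E x3 x5"
    have e': "E x5 x3" "E x5 x0" "E x3 x2" using Z_out(4)[OF x2(3) e] I by auto
    have N: "{z. E x0 z} \<inter> Z = {x1, x5}" "{z. E x1 z} \<inter> Z = {x0, x2}" "{z. E x2 z} \<inter> Z = {x1, x3}"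
      by (rule N_eq; use O inV V x0(2,3) x2(2,3) in simp)+
    have N': "{z. E x3 z} \<inter> Z = {x2, x5}" "{z. E x5 z} \<inter> Z = {x0, x3}"
      by (rule N_eq; use e e' inV x0(3,4) x2(3,4) in auto)+
    have d: "x3 \<noteq> x0" "x3 \<noteq> x1" "x3 \<noteq> x2" "x5 \<noteq> x0" "x5 \<noteq> x1" "x5 \<noteq> x2"
      using x2(4) x0(4) inV(2,4,6) by auto
    have "card (Z - {x0, x1, x2, x3, x5}) = card Z - card {x0, x1, x2, x3, x5}"
      using inV x0(3) x2(3) by (intro card_Diff_subset) auto
    also have "card {x0, x1, x2, x3, x5} = 5" using V(2-4) d d[symmetric] x35 by simp
    finally have "card (Z - {x0, x1, x2, x3, x5}) = 1" using card(1) by simp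
    then obtain s where s: "Z - {x0, x1, x2, x3, x5} = {s}" by (rule card_1_singletonE)
    have sZ: "s \<in> Z" "s \<notin> {x0, x1, x2, x3, x5}" using eqset_imp_iff[OF s, of s] by auto
    have Z6: "Z \<subseteq> {x0, x1, x2, x3, x5, s}" using s by auto
    have "s \<notin> {z. E x z} \<inter> Z" if "x \<in> {x0, x1, x2, x3, x5}" for x
      using that sZ(2) by (elim insertE emptyE) (simp_all only: N N' insert_iff empty_iff de_Morgan_disj simp_thms not_False_eq_True)
    then have "\<not> E x s" if "x \<in> {x0, x1, x2, x3, x5}" for x using that sZ(1) by blast
    then have "z \<notin> {x0, x1, x2, x3, x5, s}" if "E s z" for z
      using Z_out(4)[OF sZ(1) that] irrefl[of s] that by auto
    then have "{z. E s z} \<inter> Z = {}" using Z6 by blast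
    then show False using Z_out(3)[OF sZ(1)] by simp
  qed
  \<comment> \<open>The path of length two from x3 to x0 passes through x1, x5 or u0; the first two
    are excluded.\<close>
  have x3u0: "E x3 u0"
  proof -
    have n: "\<not> E x3 x0" unfolding I using x2(2) x35 x0(5) nQ by auto
    have "x3 \<noteq> x0" using x2(4) inV(2) by auto
    then obtain m where m: "E x3 m" "E m x0" using one_path[OF x2(3) inV(2) _ n] by auto
    have "m \<noteq> x1" using m(1) I(2) x2(4) inV u1(2) nQ by auto
    moreover have "m \<noteq> x5" using no53 m(1) by auto
    ultimately show ?thesis using m I(1) by auto
  qed
  have x5u2: "E x5 u2"
  proof -
    have n: "\<not> E x5 x2" unfolding I using x0(2) x35 x2(5) nQ by auto
    have "x5 \<noteq> x2" using x0(4) inV(6) by auto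
    then obtain m where m: "E x5 m" "E m x2" using one_path[OF x0(3) inV(6) _ n] by auto
    have "m \<noteq> x1" using m(1) I(2) x0(4) inV u1(2) nQ by auto
    moreover have "m \<noteq> x3" using no53 m(1) Z_out(4)[OF x0(3)] by auto
    ultimately show ?thesis using m I(3) by auto
  qed
  have dist: "x0 \<noteq> q" "x3 \<noteq> q" "x0 \<noteq> x3" "x2 \<noteq> q" "x5 \<noteq> q" "x2 \<noteq> x5"
    using nQ q(2) inV(2,6) x0(4) x2(4) by auto
  have In_u0: "{z. E z u0} = {x0, x3, q}"
    by (rule card_subset_eq[symmetric])
      (use x3u0 qu(1) O(1)[of u0] dist Z'_in(1)[OF x0(6)] finI[OF x0(6)] in auto)
  have In_u2: "{z. E z u2} = {x2, x5, q}"
    by (rule card_subset_eq[symmetric])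
      (use x5u2 qu(2) O(3)[of u2] dist Z'_in(1)[OF x2(6)] finI[OF x2(6)] in auto)
  have "\<not> Q \<subseteq> {u0, u1, u2, q}"
    using card_mono[of "{u0, u1, u2, q}" Q] card(2) card_length[of "[u0, u1, u2, q]"] by force
  then obtain y where y: "y \<in> Q" "y \<notin> {u0, u1, u2, q}" by auto
  have "\<not> E y u0" "\<not> E y u2" "\<not> E y q"
    using eqset_imp_iff[OF In_u0, of y] eqset_imp_iff[OF In_u2, of y] eqset_imp_iff[OF In_q, of y] y nQ
    by auto
  then have "{z. E y z} \<inter> Q \<subseteq> Q - {y, u0, u2, q}" using irrefl by blast
  then have "card ({z. E y z} \<inter> Q) \<le> card (Q - {y, u0, u2, q})"
    using fin by (intro card_mono) auto
  also have "\<dots> = 2" using card(2) y x0 x2 q u02 by (subst card_Diff_subset) auto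
  finally show False using Q_out[OF y(1)] by simp
qed


section \<open>Quotient matrices with three orbits\<close>

locale three_orbits = cyc_aut3 +
  fixes t1 t2 t3
  assumes T: "T = {t1, t2, t3}" and dist: "distinct [t1, t2, t3]"
begin

lemma inT: "t1 \<in> T" "t2 \<in> T" "t3 \<in> T" using T by auto

lemma Tsum: "(\<Sum>t\<in>T. g t) = g t1 + g t2 + g t3" for g :: "'a \<Rightarrow> int"
  using T dist by simp

lemma cardF: "card F = 13"
proof -
  have "card T = 3" using T dist by simp
  then show ?thesis using card_eq p3 by simp
qed

lemma permuted: assumes "{u1, u2, u3} = T" "distinct [u1, u2, u3]" shows "three_orbits V a r p u1 u2 u3"
  by unfold_locales (use assms in auto)

text \<open>With only two other orbits the bound behind \<open>card_T_ge3\<close> is attained: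
  \<open>S t t\<close> = 1 would need 6 from two summands, and otherwise both must equal 2.\<close>

lemma diag_offdiag: assumes t: "t \<in> T" "q \<in> T" "t \<noteq> q"
  shows "(S t q = 1 \<and> S q t = 1) \<or> (S t q = 2 \<and> S q t = 2)" "S t t = 0 \<or> S t t = 2"
proof -
  have "card T = 3" using T dist by simp
  then have "card (T - {t, q}) = 1" using t by (subst card_Diff_subset) auto
  then obtain u where "T - {t, q} = {u}" by (rule card_1_singletonE)
  then have u: "T = {t, q, u}" "u \<noteq> t" "u \<noteq> q" using t by auto
  have "W t t + W t q + W t u = 4 + S t t" using W_sum[OF t(1)] p3 u t by simp
  moreover have "S t t \<in> {0, 1, 2}" by (rule S_diag_3[OF p3 t(1)])
  moreover have "W t u \<le> 2" using W_le_2 t u by auto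
  moreover have "W t q \<le> 2" using W_le_2 t by auto
  ultimately have "W t q \<ge> 2 \<and> (S t t = 0 \<or> S t t = 2)" using W_diag_3[OF p3 t(1)] by auto
  then show "(S t q = 1 \<and> S q t = 1) \<or> (S t q = 2 \<and> S q t = 2)" "S t t = 0 \<or> S t t = 2"
    using W_eq_2[OF t(1,2)] by auto
qed

lemma S_sym: "t \<in> T \<Longrightarrow> q \<in> T \<Longrightarrow> S t q = S q t"
  using diag_offdiag(1)[of t q] by (cases "t = q") auto

text \<open>Modulo 3, equation (1, 2) reads m12 (m11 + m22 + 1) + m13 m23 = 0. Different diagonal
  entries would make m13 m23 vanish. Otherwise m12 m13 m23 is -1 for d = 0 and 1 for d = 2, so the
  number of twos among these three entries is odd or even, respectively.\<close>

lemma quotient_matrix: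
  obtains d where "d = 0 \<or> d = 2" "S t1 t1 = d" "S t2 t2 = d" "S t3 t3 = d"
    "S t1 t2 \<in> {1, 2}" "S t1 t3 \<in> {1, 2}" "S t2 t3 \<in> {1, 2}"
    "d = 0 \<Longrightarrow> S t1 t2 + S t1 t3 + S t2 t3 = 4 \<or> S t1 t2 + S t1 t3 + S t2 t3 = 6"
    "d = 2 \<Longrightarrow> S t1 t2 + S t1 t3 + S t2 t3 = 3 \<or> S t1 t2 + S t1 t3 + S t2 t3 = 5"
proof -
  have ne: "t1 \<noteq> t2" "t1 \<noteq> t3" "t2 \<noteq> t3" using dist by auto
  have sym: "S t2 t1 = S t1 t2" "S t3 t1 = S t1 t3" "S t3 t2 = S t2 t3" using S_sym inT by auto
  have o: "S t1 t2 = 1 \<or> S t1 t2 = 2" "S t1 t3 = 1 \<or> S t1 t3 = 2" "S t2 t3 = 1 \<or> S t2 t3 = 2"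
    using diag_offdiag(1)[of t1 t2] diag_offdiag(1)[of t1 t3] diag_offdiag(1)[of t2 t3] inT ne by auto
  have d: "S t1 t1 = 0 \<or> S t1 t1 = 2" "S t2 t2 = 0 \<or> S t2 t2 = 2" "S t3 t3 = 0 \<or> S t3 t3 = 2"
    using diag_offdiag(2)[of t1 t2] diag_offdiag(2)[of t2 t1] diag_offdiag(2)[of t3 t1] inT ne by auto
  define X12 where "X12 = (\<Sum>z\<in>F. a t1 z * a z t2)"
  define X13 where "X13 = (\<Sum>z\<in>F. a t1 z * a z t3)"
  define m11 m22 m33 m12 m13 m23 where "m11 = S t1 t1" and "m22 = S t2 t2" and "m33 = S t3 t3"
    and "m12 = S t1 t2" and "m13 = S t1 t3" and "m23 = S t2 t3"
  note m = m11_def[symmetric] m22_def[symmetric] m33_def[symmetric] m12_def[symmetric] m13_def[symmetric] m23_def[symmetric]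
  have e: "3 * X12 + (m11 * m12 + m12 * m22 + m13 * m23) = 12 - m12"
    "3 * X13 + (m11 * m13 + m12 * m23 + m13 * m33) = 12 - m13"
    using sq_TT3[OF inT(1,2)] sq_TT3[OF inT(1,3)] ne unfolding X12_def X13_def
    by (simp_all add: Tsum sym m)
  have o': "m12 = 1 \<or> m12 = 2" "m13 = 1 \<or> m13 = 2" "m23 = 1 \<or> m23 = 2" using o by (simp_all add: m)
  have d': "m11 = 0 \<or> m11 = 2" "m22 = 0 \<or> m22 = 2" "m33 = 0 \<or> m33 = 2" using d by (simp_all add: m)
  have q: "m11 = m22" using e(1) o' d' by (elim disjE) (simp_all, presburger+)
  have q': "m11 = m33" using e(2) o' d' by (elim disjE) (simp_all, presburger+)
  have f0: "m12 + m13 + m23 = 4 \<or> m12 + m13 + m23 = 6" if "m11 = 0"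
    using e(1) o' q that by (elim disjE) (simp_all, presburger+)
  have f2: "m12 + m13 + m23 = 3 \<or> m12 + m13 + m23 = 5" if "m11 = 2"
    using e(1) o' q that by (elim disjE) (simp_all, presburger+)
  show thesis
    by (rule that[of m11]) (use o' d' q q' f0 f2 in \<open>simp_all add: m\<close>)
qed

lemma incidence_col: assumes "t \<in> T" shows "(\<Sum>x\<in>F. a x t) = 9 - (\<Sum>s\<in>T. S s t)"
  using colsum[OF TV[OF assms]] V_sum[of "\<lambda>z. a z t"] S_col[OF _ assms] by simp

definition k where "k x = a x t1 + a x t2 + a x t3"

lemma b_k: "x \<in> F \<Longrightarrow> b x = 9 - 3 * k x"
  using b_row[of x] unfolding k_def by (simp add: Tsum)

lemma k_le2: "x \<in> F \<Longrightarrow> k x \<le> 2" and k_ge0: "0 \<le> k x"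
  using b_cases[of x] cardF b_k[of x] a_ge0 by (auto simp: k_def intro!: add_nonneg_nonneg)

lemma k_sum: assumes "x \<in> F"
  shows "(\<Sum>z\<in>F. a x z * k z) = 12 - k x - (\<Sum>s\<in>T. a x s * (\<Sum>t\<in>T. S s t))"
proof -
  have "(\<Sum>z\<in>F. a x z * k z) = (\<Sum>t\<in>T. \<Sum>z\<in>F. a x z * a z t)"
    unfolding k_def by (simp add: Tsum distrib_left sum.distrib)
  also have "\<dots> = (\<Sum>t\<in>T. 4 - a x t - (\<Sum>s\<in>T. a x s * S s t))"
    by (intro sum.cong refl) (use sq_FT[OF assms] in \<open>simp add: eq_diff_eq\<close>)
  finally show ?thesis unfolding k_def by (simp add: Tsum algebra_simps)
qed

text \<open>The sum of b over the out-neighbours of x in F is known from \<open>b3_sum\<close> up to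
  \<open>P x x\<close>, which is 0 or 3, and from \<open>k_sum\<close> by b = 9 - 3k. Comparing them
  determines \<open>P x x\<close> from the row sums of the two orbits joined to x.\<close>

lemma k2_sum: assumes x: "x \<in> F" "k x = 2"
  shows "(\<Sum>s\<in>T. a x s * (\<Sum>t\<in>T. S s t)) \<in> {4, 5}" "b x = 3"
    "P x x = 3 * (\<Sum>s\<in>T. a x s * (\<Sum>t\<in>T. S s t)) - 12"
proof -
  show b: "b x = 3" using b_k[OF x(1)] x by simp
  have "(\<Sum>z\<in>F. a x z * b z) = (\<Sum>z\<in>F. 9 * a x z - 3 * (a x z * k z))"
    by (intro sum.cong refl) (simp add: b_k right_diff_distrib)
  also have "\<dots> = 9 * b x - 3 * (\<Sum>z\<in>F. a x z * k z)"
    unfolding b_def[of x] by (simp add: sum_subtractf sum_distrib_left)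
  finally have "(\<Sum>z\<in>F. a x z * b z) = 27 - 3 * (10 - (\<Sum>s\<in>T. a x s * (\<Sum>t\<in>T. S s t)))"
    using k_sum[OF x(1)] b x by simp
  then show "(\<Sum>s\<in>T. a x s * (\<Sum>t\<in>T. S s t)) \<in> {4, 5}"
    "P x x = 3 * (\<Sum>s\<in>T. a x s * (\<Sum>t\<in>T. S s t)) - 12"
    using b3_sum[OF x(1) b] cardF by auto
qed

text \<open>If k never exceeds 1, a vertex with k = 0 would need \<open>k_sum\<close> = 12 from only
  9 out-neighbours. So k is constantly 1, and the 13 arcs into the representatives make the total 27
  - 13 = 14.\<close>

lemma not_all_k_le1: assumes "(\<Sum>t\<in>T. \<Sum>s\<in>T. S t s) \<noteq> 14" shows "\<exists>x\<in>F. k x = 2"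
proof (rule ccontr)
  assume "\<not> ?thesis"
  then have le1: "k x \<le> 1" if "x \<in> F" for x using k_le2[OF that] that by force
  have "k x = 1" if x: "x \<in> F" for x
  proof (rule ccontr)
    assume "k x \<noteq> 1"
    then have k0: "k x = 0" using le1[OF x] k_ge0[of x] by simp
    then have "a x t1 = 0" "a x t2 = 0" "a x t3 = 0"
      using a_ge0[of x t1] a_ge0[of x t2] a_ge0[of x t3] unfolding k_def by auto
    then have "(\<Sum>z\<in>F. a x z * k z) = 12" using k_sum[OF x] k0 by (simp add: Tsum)
    moreover have "(\<Sum>z\<in>F. a x z * k z) \<le> (\<Sum>z\<in>F. a x z)"
      by (rule sum_mono) (use le1 a_ge0 in \<open>metis mult.right_neutral mult_left_mono\<close>)
    ultimately show False using b_k[OF x] k0 unfolding b_def by simp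
  qed
  then have "(\<Sum>x\<in>F. k x) = 13" using cardF by simp
  moreover have "(\<Sum>x\<in>F. k x) = 27 - (\<Sum>t\<in>T. \<Sum>s\<in>T. S t s)"
    unfolding k_def sum.distrib using incidence_col[OF inT(1)] incidence_col[OF inT(2)] incidence_col[OF inT(3)]
    by (simp add: Tsum)
  ultimately show False using assms by simp
qed

text \<open>The totals allowed by \<open>quotient_matrix\<close> are 8, 12 and 16, so some x has k =
  2, and \<open>k2_sum\<close> bounds two row sums together by 5. All row sums are at least 4 unless
  d = 0 and the off-diagonal entries are 2, 1, 1.\<close>

lemma quotient_matrix_unique:
  obtains u1 u2 u3 where "three_orbits V a r p u1 u2 u3"
    "S u1 u1 = 0" "S u2 u2 = 0" "S u3 u3 = 0" "S u1 u2 = 2" "S u1 u3 = 1" "S u2 u3 = 1"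
proof -
  obtain d where d: "d = 0 \<or> d = 2" "S t1 t1 = d" "S t2 t2 = d" "S t3 t3 = d"
    "S t1 t2 \<in> {1, 2}" "S t1 t3 \<in> {1, 2}" "S t2 t3 \<in> {1, 2}"
    "d = 0 \<Longrightarrow> S t1 t2 + S t1 t3 + S t2 t3 = 4 \<or> S t1 t2 + S t1 t3 + S t2 t3 = 6"
    "d = 2 \<Longrightarrow> S t1 t2 + S t1 t3 + S t2 t3 = 3 \<or> S t1 t2 + S t1 t3 + S t2 t3 = 5"
    by (rule quotient_matrix) (rule that)
  have sym: "S t2 t1 = S t1 t2" "S t3 t1 = S t1 t3" "S t3 t2 = S t2 t3" using S_sym inT by auto
  have tot: "(\<Sum>t\<in>T. \<Sum>s\<in>T. S t s) = 3 * d + 2 * (S t1 t2 + S t1 t3 + S t2 t3)"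
    using d(2-4) sym by (simp add: Tsum)
  have "(\<Sum>t\<in>T. \<Sum>s\<in>T. S t s) \<noteq> 14" using tot d(1,8,9) by auto
  then obtain x where x: "x \<in> F" "k x = 2" using not_all_k_le1 by auto
  have "(a x t1, a x t2, a x t3) \<in> {(1, 1, 0), (1, 0, 1), (0, 1, 1)}"
    using x(2) a01[of x t1] a01[of x t2] a01[of x t3] unfolding k_def by auto
  then have d0: "d = 0 \<and> S t1 t2 + S t1 t3 + S t2 t3 = 4"
    using k2_sum(1)[OF x] d sym by (auto simp: Tsum)
  then consider "S t1 t2 = 2" "S t1 t3 = 1" "S t2 t3 = 1" | "S t1 t2 = 1" "S t1 t3 = 2" "S t2 t3 = 1"
    | "S t1 t2 = 1" "S t1 t3 = 1" "S t2 t3 = 2" using d(5-7) by auto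
  then show thesis
  proof cases
    case 1
    show thesis by (rule that[of t1 t2 t3]) (use 1 d0 d(2-4) sym T dist permuted[of t1 t2 t3] in auto)
  next
    case 2
    show thesis by (rule that[of t1 t3 t2]) (use 2 d0 d(2-4) sym T dist permuted[of t1 t3 t2] in auto)
  next
    case 3
    show thesis by (rule that[of t2 t3 t1]) (use 3 d0 d(2-4) sym T dist permuted[of t2 t3 t1] in auto)
  qed
qed

end


section \<open>The remaining 3 x 3 quotient matrix\<close>

locale quotient_211 = three_orbits +
  assumes S_diag0: "S t1 t1 = 0" "S t2 t2 = 0" "S t3 t3 = 0"
    and S_off: "S t1 t2 = 2" "S t1 t3 = 1" "S t2 t3 = 1"
begin

lemma S_off': "S t2 t1 = 2" "S t3 t1 = 1" "S t3 t2 = 1"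
  using S_sym[OF inT(2,1)] S_sym[OF inT(3,1)] S_sym[OF inT(3,2)] S_off by auto

lemmas S_table = S_diag0 S_off S_off'

lemma dual_quotient_211: "quotient_211 V (\<lambda>x y. a y x) r p t1 t2 t3"
proof -
  interpret dual: cyc_aut3 V "\<lambda>x y. a y x" r p by (rule dual3)
  show ?thesis by unfold_locales (use T dist S_table inT in \<open>simp_all add: dual_S\<close>)
qed

lemma swap12: "quotient_211 V a r p t2 t1 t3"
  by unfold_locales (use T dist S_table in auto)

lemma row_sums: "(\<Sum>t\<in>T. S t1 t) = 3" "(\<Sum>t\<in>T. S t2 t) = 3" "(\<Sum>t\<in>T. S t3 t) = 2"
  by (simp_all add: Tsum S_table)

lemma incidence_sums: "(\<Sum>x\<in>F. a x t1) = 6" "(\<Sum>x\<in>F. a x t2) = 6" "(\<Sum>x\<in>F. a x t3) = 7"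
  using incidence_col[OF inT(1)] incidence_col[OF inT(2)] incidence_col[OF inT(3)]
  by (simp_all add: Tsum S_table)

text \<open>Rows t1 and t2 sum to 3 each, and 6 exceeds the bound 5 of
  \<open>k2_sum\<close>.\<close>

lemma not_12: assumes x: "x \<in> F" shows "a x t1 = 0 \<or> a x t2 = 0"
proof (rule ccontr)
  assume "\<not> ?thesis"
  then have 12: "a x t1 = 1" "a x t2 = 1" using a01[of x t1] a01[of x t2] by auto
  then have 3: "a x t3 = 0" "k x = 2" using k_le2[OF x] a01[of x t3] unfolding k_def by auto
  show False using k2_sum(1)[OF x 3(2)] 12 3 by (simp add: Tsum S_table)
qed

lemma ex_k2: "\<exists>x\<in>F. k x = 2"
  by (rule not_all_k_le1) (simp add: Tsum S_table)

lemma k2_cases: assumes "x \<in> F" "k x = 2"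
  shows "a x t3 = 1" "(a x t1 = 1 \<and> a x t2 = 0) \<or> (a x t1 = 0 \<and> a x t2 = 1)"
  using assms not_12[of x] a01[of x t1] a01[of x t2] a01[of x t3] unfolding k_def by auto

lemma k2_P: assumes x: "x \<in> F" "k x = 2" shows "b x = 3" "P x x = 3"
  using k2_sum[OF x] k2_cases[OF x] by (auto simp: Tsum S_table)

lemma k2_L: assumes x: "x \<in> F" "k x = 2" and y: "y \<in> F" shows "L x y = 1"
proof (cases "x = y")
  case True
  then show ?thesis using P_L[OF x(1) y] k2_P[OF x] noloop[of x] FV x by auto
next
  case False
  then show ?thesis using P_L[OF x(1) y] P_if_b3[OF x(1) k2_P(1)[OF x] y] by simp
qed

end

text \<open>The matrix is symmetric in t1 and t2; \<open>ex13\<close> decides which of them shares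
  an in-neighbour in F with t3.\<close>

locale joined_211 = quotient_211 +
  assumes ex13: "\<exists>x\<in>F. a x t1 = 1 \<and> a x t3 = 1"
begin

lemma k_13: assumes "x \<in> F" "a x t1 = 1" "a x t3 = 1" shows "a x t2 = 0" "k x = 2"
  using not_12[OF assms(1)] assms unfolding k_def by auto

lemma out_13: assumes y: "y \<in> F" shows "a t1 y + a t3 y = 1"
proof -
  obtain x where x: "x \<in> F" "a x t1 = 1" "a x t3 = 1" using ex13 by auto
  show ?thesis using k2_L[OF x(1) k_13(2)[OF x] y] x k_13[OF x] by (simp add: L_def Tsum)
qed

text \<open>Such an x would give the analogue of \<open>out_13\<close> for t2 and t3, so t1 and t2
  would have the same out-neighbours in F. By \<open>not_12\<close> for the reversed digraph there
  would be none, whereas t1 has 9 - 3 of them.\<close>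

lemma not_23: assumes x: "x \<in> F" shows "a x t2 = 0 \<or> a x t3 = 0"
proof (rule ccontr)
  interpret dual: quotient_211 V "\<lambda>x y. a y x" r p t1 t2 t3 by (rule dual_quotient_211)
  assume "\<not> ?thesis"
  then have 23: "a x t2 = 1" "a x t3 = 1" using a01[of x t2] a01[of x t3] by auto
  then have 1: "a x t1 = 0" "k x = 2" using not_12[OF x] unfolding k_def by auto
  have "a t1 y = 0" if y: "y \<in> F" for y
    using k2_L[OF x 1(2) y] out_13[OF y] dual.not_12[OF y] 23 1 by (auto simp: L_def Tsum)
  then have "(\<Sum>y\<in>F. a t1 y) = 0" by simp
  then show False using row_T[OF inT(1)] row_sums by simp
qed

text \<open>Sum the nonnegative functions \<open>h\<close> and \<open>g\<close> over \<open>F\<close>: the total is 13 - 6 - 7 = 0.\<close>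

lemma in_types: assumes x: "x \<in> F" shows "a x t1 \<le> a x t3" "a x t2 = 1 - a x t3"
proof -
  define h where "h x = 1 - (a x t1 + a x t2 + a x t3) + a x t1 * a x t3" for x
  define g where "g x = a x t1 * (1 - a x t3)" for x
  have ge0: "0 \<le> h u" "0 \<le> g u" if "u \<in> F" for u
    using not_12[OF that] not_23[OF that] a01[of u t1] a01[of u t2] a01[of u t3]
    unfolding h_def g_def by auto
  have "(\<Sum>x\<in>F. h x + g x) = (\<Sum>x\<in>F. 1 - a x t2 - a x t3)"
    unfolding h_def g_def by (intro sum.cong) (auto simp: algebra_simps)
  also have "\<dots> = 0" using incidence_sums cardF by (simp add: sum_subtractf)
  finally have "h x + g x = 0" using ge0 x by (subst (asm) sum_nonneg_eq_0_iff) (auto simp: add_nonneg_nonneg)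
  then have "h x = 0" "g x = 0" using ge0[OF x] by auto
  then show "a x t1 \<le> a x t3" "a x t2 = 1 - a x t3"
    using a01[of x t1] a01[of x t2] a01[of x t3] unfolding h_def g_def by auto
qed

text \<open>Reversal exchanges t1 and t2: by \<open>out_13\<close> no fixed vertex is an
  out-neighbour of both t1 and t3, so the vertex supplied by the reversed \<open>ex_k2\<close> is
  one of t2 and t3.\<close>

lemma dual13: "joined_211 V (\<lambda>x y. a y x) r p t2 t1 t3"
proof -
  interpret dual: quotient_211 V "\<lambda>x y. a y x" r p t1 t2 t3 by (rule dual_quotient_211)
  interpret sw: quotient_211 V "\<lambda>x y. a y x" r p t2 t1 t3 by (rule dual.swap12)
  obtain y where y: "y \<in> F" "dual.k y = 2" using dual.ex_k2 by auto
  have "a t3 y = 1" "(a t1 y = 1 \<and> a t2 y = 0) \<or> (a t1 y = 0 \<and> a t2 y = 1)"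
    using dual.k2_cases[OF y] by auto
  then have "a t2 y = 1" "a t3 y = 1" using out_13[OF y(1)] by auto
  then show ?thesis by unfold_locales (use y in auto)
qed

lemma card_arcs: "(\<Sum>z\<in>F. a x z * a z y) = int (card {z \<in> F. a x z = 1 \<and> a z y = 1})"
proof -
  have "a x z * a z y = 1 \<longleftrightarrow> a x z = 1 \<and> a z y = 1" "a x z * a z y = 0 \<or> a x z * a z y = 1" for z
    using a01[of x z] a01[of z y] by auto
  then show ?thesis using sum_01_eq_card[of F "\<lambda>z. a x z * a z y"] by simp
qed

text \<open>Through \<open>dual13\<close> these also describe the in-arcs of the out-neighbours of
  t2.\<close>

lemma Z_facts: assumes x: "x \<in> F" "a x t1 = 1"
  shows "card {z \<in> F. a x z = 1} = 3" "card {z \<in> F. a x z = 1 \<and> a z t1 = 1} = 2"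
    and "z \<in> F \<Longrightarrow> a x z = 1 \<Longrightarrow> a z x = 1"
    and "z \<in> F \<Longrightarrow> a x z = 1 \<Longrightarrow> a z t1 = 1 \<or> a z t2 = 1"
    and "y \<in> F \<Longrightarrow> y \<noteq> x \<Longrightarrow> int (card {m \<in> F. a x m = 1 \<and> a m y = 1}) = 1 - a x y"
proof -
  have x3: "a x t3 = 1" "a x t2 = 0" using in_types[OF x(1)] x(2) a_le1[of x t3] by auto
  then have k: "k x = 2" using k_13 x by simp
  note bP = k2_P[OF x(1) k]
  show "card {z \<in> F. a x z = 1} = 3" using sum_01_eq_card[of F "a x"] a01 bP unfolding b_def by simp
  have s1: "(\<Sum>z\<in>F. a x z * a z t1) = 2" using sq_FT[OF x(1) inT(1)] x x3 by (simp add: Tsum S_table)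
  then show "card {z \<in> F. a x z = 1 \<and> a z t1 = 1} = 2" using card_arcs[of x t1] by simp
  have s2: "(\<Sum>z\<in>F. a x z * a z t2) = 1" using sq_FT[OF x(1) inT(2)] x x3 by (simp add: Tsum S_table)
  show "a z x = 1" if "z \<in> F" "a x z = 1" using F_sym[of x z] x bP that a01[of z x] by auto
  show "a z t1 = 1 \<or> a z t2 = 1" if z: "z \<in> F" "a x z = 1"
  proof -
    have "(\<Sum>z\<in>F. a x z * (1 - a z t1 - a z t2)) = 0"
      using s1 s2 bP(1) unfolding b_def by (simp add: right_diff_distrib sum_subtractf)
    moreover have "0 \<le> a x z * (1 - a z t1 - a z t2)" if "z \<in> F" for z
      using not_12[OF that] a_le1[of z t1] a_le1[of z t2] a_ge0[of x z] by auto
    ultimately have "a x z * (1 - a z t1 - a z t2) = 0"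
      using z(1) by (subst (asm) sum_nonneg_eq_0_iff) auto
    then show ?thesis using z(2) a01[of z t1] a01[of z t2] by auto
  qed
  show "int (card {m \<in> F. a x m = 1 \<and> a m y = 1}) = 1 - a x y" if "y \<in> F" "y \<noteq> x"
    using P_if_b3[OF x(1) bP(1) that] card_arcs[of x y] unfolding P_def by simp
qed

text \<open>Count the arcs within \<open>F\<close> that enter the in-neighbours of \<open>t1\<close> in two ways.\<close>

lemma card_ZZ': "card {x \<in> F. a x t1 = 1 \<and> a t2 x = 1} = 3"
proof -
  have m: "(\<Sum>y\<in>F. a x y * a y t1) = 4 - a x t1 - 2 * a x t2 - a x t3" if "x \<in> F" for x
    using sq_FT[OF that inT(1)] by (simp add: Tsum S_table)
  have i: "(\<Sum>x\<in>F. a x y) = 6 - 3 * a t2 y" if "y \<in> F" for y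
    using b_col[OF that] out_13[OF that] by (simp add: Tsum)
  have "(\<Sum>x\<in>F. \<Sum>y\<in>F. a x y * a y t1) = (\<Sum>x\<in>F. 4 - a x t1 - 2 * a x t2 - a x t3)"
    using m by (intro sum.cong) auto
  also have "\<dots> = 27" using incidence_sums cardF by (simp add: sum_subtractf sum_distrib_left[symmetric])
  finally have "27 = (\<Sum>y\<in>F. (\<Sum>x\<in>F. a x y) * a y t1)"
    by (subst (asm) sum.swap) (simp add: sum_distrib_right)
  also have "\<dots> = (\<Sum>y\<in>F. 6 * a y t1 - 3 * (a t2 y * a y t1))"
    by (intro sum.cong refl) (simp add: i left_diff_distrib)
  also have "\<dots> = 36 - 3 * (\<Sum>y\<in>F. a t2 y * a y t1)"
    using incidence_sums by (simp add: sum_subtractf sum_distrib_left[symmetric])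
  finally have "(\<Sum>y\<in>F. a t2 y * a y t1) = 3" by simp
  then show ?thesis using card_arcs[of t2 t1] by (simp add: conj_commute)
qed

text \<open>By \<open>in_types\<close> and the counts 6 and 7, the in-neighbours of t3 in F are
  those of t1 and one more vertex, y. Now x has 3 out-neighbours among the former and 2 among the
  latter, so y is one of them.\<close>

lemma Q_facts: assumes x: "x \<in> F" "a x t2 = 1"
  shows "card {z \<in> F. a x z = 1 \<and> a z t2 = 1} = 3"
    and "y \<in> F \<Longrightarrow> a y t1 = 0 \<Longrightarrow> a y t2 = 0 \<Longrightarrow> a x y = 1"
proof -
  have x3: "a x t3 = 0" "a x t1 = 0" using in_types[OF x(1)] x(2) a_ge0[of x t1] by auto
  have s: "(\<Sum>z\<in>F. a x z * a z t1) = 2" "(\<Sum>z\<in>F. a x z * a z t2) = 3" "(\<Sum>z\<in>F. a x z * a z t3) = 3"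
    using sq_FT[OF x(1) inT(1)] sq_FT[OF x(1) inT(2)] sq_FT[OF x(1) inT(3)] x x3
    by (simp_all add: Tsum S_table)
  then show "card {z \<in> F. a x z = 1 \<and> a z t2 = 1} = 3" using card_arcs[of x t2] by simp
  assume y: "y \<in> F" "a y t1 = 0" "a y t2 = 0"
  have gy: "a y t3 - a y t1 = 1" using in_types(2)[OF y(1)] y by simp
  have "(\<Sum>z\<in>F. a z t3 - a z t1) = 1" using incidence_sums by (simp add: sum_subtractf)
  then have "(\<Sum>z\<in>F - {y}. a z t3 - a z t1) = 0" using gy y(1) by (simp add: sum.remove[of F y])
  then have g0: "a z t3 - a z t1 = 0" if "z \<in> F - {y}" for z
    using that in_types(1) by (subst (asm) sum_nonneg_eq_0_iff) auto
  have "(\<Sum>z\<in>F. a x z * (a z t3 - a z t1)) = 1" using s by (simp add: right_diff_distrib sum_subtractf)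
  moreover have "(\<Sum>z\<in>F. a x z * (a z t3 - a z t1)) = a x y * (a y t3 - a y t1) + (\<Sum>z\<in>F - {y}. a x z * (a z t3 - a z t1))"
    using y(1) by (simp add: sum.remove)
  moreover have "(\<Sum>z\<in>F - {y}. a x z * (a z t3 - a z t1)) = 0"
    by (rule sum.neutral) (use g0 in auto)
  ultimately show "a x y = 1" using gy by simp
qed

lemma contradiction: False
proof -
  interpret dual: joined_211 V "\<lambda>x y. a y x" r p t2 t1 t3 by (rule dual13)
  define E where "E x y \<longleftrightarrow> x \<in> F \<and> y \<in> F \<and> a x y = 1" for x y
  define Z Q Z' where "Z = {x \<in> F. a x t1 = 1}" and "Q = {x \<in> F. a x t2 = 1}" and "Z' = {x \<in> F. a t2 x = 1}"
  note defs = Z_def Q_def Z'_def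
  have cZ: "card Z = 6" "card Q = 6"
    using sum_01_eq_card[of F "\<lambda>x. a x t1"] sum_01_eq_card[of F "\<lambda>x. a x t2"] a01 incidence_sums unfolding defs by simp_all
  have cZ': "card Z' = 6" using sum_01_eq_card[of F "a t2"] a01 dual.incidence_sums(1) unfolding defs by simp
  have cI: "card (Z \<inter> Z') = 3" using card_ZZ' unfolding defs by (simp add: Int_def conj_ac)
  have N: "{z. E x z} = {z \<in> F. a x z = 1}" if "x \<in> F" for x using that unfolding E_def by auto
  have I: "{z. E z x} = {z \<in> F. a z x = 1}" if "x \<in> F" for x using that unfolding E_def by auto
  \<comment> \<open>A vertex outside Z and Q receives arcs from all six vertices of Q, whereas a
    vertex of Z' has only three in-neighbours in F.\<close>
  have sub: "Z' \<subseteq> Z \<union> Q"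
  proof
    fix y assume y: "y \<in> Z'"
    show "y \<in> Z \<union> Q"
    proof (rule ccontr)
      assume "y \<notin> Z \<union> Q"
      then have "a y t1 = 0" "a y t2 = 0" "y \<in> F" using y a01[of y t1] a01[of y t2] unfolding defs by auto
      then have "Q \<subseteq> {z \<in> F. a z y = 1}" using Q_facts(2) unfolding defs by auto
      then have "card Q \<le> card {z \<in> F. a z y = 1}" by (intro card_mono) auto
      then show False using dual.Z_facts(1)[of y] y cZ unfolding defs by simp
    qed
  qed
  have disj: "Z \<inter> Q = {}" using not_12 unfolding defs by force
  have "Z' = (Z \<inter> Z') \<union> (Z' \<inter> Q)" using sub by auto
  moreover have "card ((Z \<inter> Z') \<union> (Z' \<inter> Q)) = card (Z \<inter> Z') + card (Z' \<inter> Q)"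
    by (rule card_Un_disjoint) (use disj in \<open>auto simp: defs\<close>)
  ultimately have cW: "card (Z' \<inter> Q) = 3" using cZ' cI by simp
  show False
  proof (rule hexagon_contradiction[of Z Q Z' E])
    show "finite Z" "finite Q" "finite Z'" unfolding defs by auto
    show "\<not> E x x" for x unfolding E_def using noloop FV by auto
    fix x
    assume xZ: "x \<in> Z"
    then have x: "x \<in> F" "a x t1 = 1" unfolding defs by auto
    show "{z. E x z} \<subseteq> Z \<union> Q" using Z_facts(4)[OF x] unfolding N[OF x(1)] unfolding defs by auto
    show "card {z. E x z} = 3" using Z_facts(1)[OF x] N[OF x(1)] by simp
    have "{z. E x z} \<inter> Z = {z \<in> F. a x z = 1 \<and> a z t1 = 1}" unfolding N[OF x(1)] unfolding defs by auto
    then show "card ({z. E x z} \<inter> Z) = 2" using Z_facts(2)[OF x] by simp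
    show "E x z \<Longrightarrow> E z x" for z using Z_facts(3)[OF x] unfolding E_def by auto
    fix y
    have paths: "{m. E x m \<and> E m y} = {m \<in> F. a x m = 1 \<and> a m y = 1}" if "y \<in> F"
      using that x unfolding E_def by auto
    show "E x y \<Longrightarrow> E x m \<Longrightarrow> \<not> E m y" for m
    proof
      assume e: "E x y" "E x m" "E m y"
      then have y: "y \<in> F" "y \<noteq> x" "a x y = 1" using noloop x FV unfolding E_def by auto
      then have "card {m. E x m \<and> E m y} = 0" using Z_facts(5)[OF x y(1,2)] paths by simp
      moreover have "finite {m. E x m \<and> E m y}" using paths[OF y(1)] by simp
      ultimately show False using e by auto
    qed
    assume y: "y \<in> Z'" "x \<noteq> y" "\<not> E x y"
    then have y': "y \<in> F" "y \<noteq> x" "a x y = 0" using a01[of x y] x unfolding E_def defs by auto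
    then have "card {m. E x m \<and> E m y} = 1" using Z_facts(5)[OF x y'(1,2)] paths by simp
    then obtain m where m: "{m. E x m \<and> E m y} = {m}" by (rule card_1_singletonE)
    have "E x m' \<and> E m' y \<longleftrightarrow> m' = m" for m' using eqset_imp_iff[OF m, of m'] by simp
    then show "\<exists>!m. E x m \<and> E m y" by simp
  next
    fix y assume "y \<in> Z'"
    then have y: "y \<in> F" "a t2 y = 1" unfolding defs by auto
    show "card {z. E z y} = 3" using dual.Z_facts(1)[OF y] I[OF y(1)] by simp
    have "{z. E z y} \<inter> Z' = {z \<in> F. a z y = 1 \<and> a t2 z = 1}" unfolding I[OF y(1)] unfolding defs by auto
    then show "card ({z. E z y} \<inter> Z') = 2" using dual.Z_facts(2)[OF y] by simp
    show "E z y \<Longrightarrow> E y z" for z using dual.Z_facts(3)[OF y] unfolding E_def by auto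
  next
    fix x assume "x \<in> Q"
    then have x: "x \<in> F" "a x t2 = 1" unfolding defs by auto
    have "{z. E x z} \<inter> Q = {z \<in> F. a x z = 1 \<and> a z t2 = 1}" unfolding N[OF x(1)] unfolding defs by auto
    then show "card ({z. E x z} \<inter> Q) = 3" using Q_facts(1)[OF x] by simp
  qed (fact cZ cI cW sub disj)+
qed

end

section \<open>Conclusion for order 3\<close>

context cyc_aut3
begin

lemma card_F_not_13: "card F \<noteq> 13"
proof
  assume f: "card F = 13"
  then have "card T = 3" using card_eq p3 by simp
  then obtain t1 t2 t3 where "T = {t1, t2, t3}" "distinct [t1, t2, t3]"
    by (auto simp: card_3_iff)
  then interpret three_orbits V a r p t1 t2 t3 by unfold_locales
  obtain u1 u2 u3 where u: "three_orbits V a r p u1 u2 u3"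
    "S u1 u1 = 0" "S u2 u2 = 0" "S u3 u3 = 0" "S u1 u2 = 2" "S u1 u3 = 1" "S u2 u3 = 1"
    by (rule quotient_matrix_unique)
  interpret u: quotient_211 V a r p u1 u2 u3
    using u by (simp add: quotient_211_def quotient_211_axioms_def)
  interpret v: quotient_211 V a r p u2 u1 u3 by (rule u.swap12)
  obtain x where x: "x \<in> F" "u.k x = 2" using u.ex_k2 by auto
  have "a x u3 = 1" "a x u1 = 1 \<or> a x u2 = 1" using u.k2_cases[OF x] by auto
  then show False
  proof (elim disjE)
    assume "a x u1 = 1" "a x u3 = 1"
    then have "joined_211 V a r p u1 u2 u3" using x by unfold_locales auto
    then show False by (rule joined_211.contradiction)
  next
    assume "a x u2 = 1" "a x u3 = 1"
    then have "joined_211 V a r p u2 u1 u3" using x by unfold_locales auto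
    then show False by (rule joined_211.contradiction)
  qed
qed

lemma card_fixed_order_3: "card F = 1"
proof -
  have "card T \<ge> 3" using card_T_ge3 p3 by auto
  moreover have "card F + 3 * card T = 22" using card_eq p3 by simp
  moreover have "n \<in> {1, 4, 7, 10, 13}" if "3 \<le> m" "n + 3 * m = 22" for n m :: nat
    using that unfolding insert_iff empty_iff by presburger
  ultimately show ?thesis using card_F_not_4_7 card_F_not_10 card_F_not_13 by blast
qed

end

section \<open>From the digraph to its adjacency matrix\<close>

context dsrg
begin

lemma degree_sums:
  assumes "x \<in> pverts G"
  shows "(\<Sum>y\<in>pverts G. of_bool ((x, y) \<in> parcs G)) = int k"
    and "(\<Sum>y\<in>pverts G. of_bool ((y, x) \<in> parcs G)) = int k"
proof -
  have "out_arcs (with_proj G) x = Pair x ` {y \<in> pverts G. (x, y) \<in> parcs G}"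
    "in_arcs (with_proj G) x = (\<lambda>y. (y, x)) ` {y \<in> pverts G. (y, x) \<in> parcs G}"
    using arc_fst_in_verts arc_snd_in_verts by (force simp: out_arcs_def in_arcs_def)+
  then have "card {y \<in> pverts G. (x, y) \<in> parcs G} = k" "card {y \<in> pverts G. (y, x) \<in> parcs G} = k"
    using out_deg[OF assms] in_deg[OF assms] unfolding out_degree_def in_degree_def
    by (simp_all add: card_image inj_on_def)
  then show "(\<Sum>y\<in>pverts G. of_bool ((x, y) \<in> parcs G)) = int k"
    "(\<Sum>y\<in>pverts G. of_bool ((y, x) \<in> parcs G)) = int k"
    using pair_finite_verts by (simp_all add: Int_def)
qed

lemma path_count:
  assumes "x \<in> pverts G" "y \<in> pverts G"
  shows "(\<Sum>z\<in>pverts G. of_bool ((x, z) \<in> parcs G) * of_bool ((z, y) \<in> parcs G))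
    = (if x = y then int t else if (x, y) \<in> parcs G then int lam else int mu)"
proof -
  have "(\<Sum>z\<in>pverts G. of_bool ((x, z) \<in> parcs G) * of_bool ((z, y) \<in> parcs G))
      = int (card {z \<in> pverts G. (x, z) \<in> parcs G \<and> (z, y) \<in> parcs G})"
    using pair_finite_verts by (simp add: Int_def flip: of_bool_conj)
  then show ?thesis
    using reciprocal[of x] paths_adjacent[of x y] paths_nonadjacent[of x y] assms by auto
qed

end

lemma automorphism_group_pow: "\<rho> [^]\<^bsub>automorphism_group G\<^esub> (n :: nat) = \<rho> ^^ n"
  by (induction n) (simp_all add: automorphism_group_def nat_pow_def funpow_swap1 fun_eq_iff)

lemma cyc_aut_of_automorphism:
  fixes G :: "'a pair_pre_digraph"
  assumes "dsrg G 22 9 6 3 4" and aut: "digraph_automorphism G \<rho>" and p: "prime p"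
    and ord: "group.ord (automorphism_group G) \<rho> = p"
  shows "cyc_aut (pverts G) (\<lambda>x y. of_bool ((x, y) \<in> parcs G)) \<rho> p"
proof -
  interpret dsrg G 22 9 6 3 4 by fact
  interpret A: group "automorphism_group G" by (rule group_automorphism_group)
  have carr: "\<rho> \<in> carrier (automorphism_group G)" using aut by (simp add: automorphism_group_def)
  have perm: "\<rho> permutes pverts G" using aut by (simp add: digraph_automorphism_def)
  have one: "\<one>\<^bsub>automorphism_group G\<^esub> = id" by (simp add: automorphism_group_def)
  have pow: "\<rho> ^^ p = id"
    using A.pow_ord_eq_1[OF carr] ord one by (simp add: automorphism_group_pow)
  have "\<rho> \<noteq> id"
  proof
    assume "\<rho> = id"
    then have "p = 1" using A.ord_id ord one by simp
    then show False using p by simp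
  qed
  then obtain x where x: "\<rho> x \<noteq> x" by (auto simp: fun_eq_iff)
  then have "x \<in> pverts G" using perm by (meson permutes_def)
  show ?thesis
  proof unfold_locales
    show "finite (pverts G)" by (rule pair_finite_verts)
    show "card (pverts G) = 22" by (rule card_verts)
    show "of_bool ((u, v) \<in> parcs G) = (0 :: int) \<or> of_bool ((u, v) \<in> parcs G) = (1 :: int)" for u v
      by simp
    show "prime p" by fact
    show "\<rho> permutes pverts G" by fact
    show "(\<rho> ^^ p) y = y" for y using pow by simp
    show "\<exists>x\<in>pverts G. \<rho> x \<noteq> x" using x \<open>x \<in> pverts G\<close> by auto
    fix u assume u: "u \<in> pverts G"
    show "of_bool ((u, u) \<in> parcs G) = (0 :: int)" using pair_no_loops[of "(u, u)"] by auto
    show "(\<Sum>y\<in>pverts G. of_bool ((u, y) \<in> parcs G)) = (9 :: int)"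
      "(\<Sum>y\<in>pverts G. of_bool ((y, u) \<in> parcs G)) = (9 :: int)"
      using degree_sums[OF u] by simp_all
    fix v assume v: "v \<in> pverts G"
    show "of_bool ((\<rho> u, \<rho> v) \<in> parcs G) = (of_bool ((u, v) \<in> parcs G) :: int)"
      using aut u v by (simp add: digraph_automorphism_def)
    have "(v, v) \<notin> parcs G" using pair_no_loops[of "(v, v)"] by auto
    then show "(\<Sum>z\<in>pverts G. of_bool ((u, z) \<in> parcs G) * of_bool ((z, v) \<in> parcs G))
        = 4 - of_bool ((u, v) \<in> parcs G) + (if u = v then 2 else 0 :: int)"
      unfolding path_count[OF u v] by simp
  qed
qed

theorem theorem4p1:
  fixes G :: "'a pair_pre_digraph" and \<rho> :: "'a \<Rightarrow> 'a" and p :: nat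
  assumes "dsrg G 22 9 6 3 4"
    and "digraph_automorphism G \<rho>"
    and "prime p"
    and "group.ord (automorphism_group G) \<rho> = p"
  shows "p \<in> {2, 3} \<and>
    (p = 2 \<longrightarrow> card {x \<in> pverts G. \<rho> x = x} \<in> {0, 6, 8, 10, 12, 14, 16}) \<and>
    (p = 3 \<longrightarrow> card {x \<in> pverts G. \<rho> x = x} = 1)"
proof -
  interpret C: cyc_aut "pverts G" "\<lambda>x y. of_bool ((x, y) \<in> parcs G)" \<rho> p
    using assms by (rule cyc_aut_of_automorphism)
  have "card {x \<in> pverts G. \<rho> x = x} = 1" if "p = 3"
  proof -
    interpret cyc_aut3 "pverts G" "\<lambda>x y. of_bool ((x, y) \<in> parcs G)" \<rho> p
      by unfold_locales (fact that)
    show ?thesis using card_fixed_order_3 unfolding C.F_def .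
  qed
  then show ?thesis using C.order_2_or_3 C.card_fixed_order_2 unfolding C.F_def by auto
qed

end
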